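(* Let $d\ge 1$, $\beta>d$, and let $f:[0,\infty)\to[0,\infty]$ be measurable such that for some $\varrho>0$: $f(r)=r^{-\beta}$ for $0\le r\le\varrho$, $\sup_{r\ge\varrho}f(r)<\infty$, and $\int_\varrho^\infty r^{d-1}f(r)\,dr<\infty$. For $\lambda>0$ let $\tilde\Phi_\lambda=\{(x_i,\mathbf{p}_i)\}$ be an independently marked Poisson point process on $\mathbb{R}^d$ of intensity $\lambda$ whose marks take values in $(0,\infty)$ with common distribution $F$ satisfying $\mathbb{E}[\mathbf{p}]=\int p\,F(dp)<\infty$. Define $\mathcal{I}_\lambda(f;z)=\sum_{(x_i,\mathbf{p}_i)\in\tilde\Phi_\lambda}\mathbf{p}_i f(\|x_i-z\|)$, $\kappa=\beta/d$, $\alpha=d/\beta$, and $\hat{\mathcal{I}}_\lambda(f;z)=\lambda^{-\kappa}\mathcal{I}_\lambda(f;z)$. Let $x_1,\dots,x_k$ be $k$ distinct points of $\mathbb{R}^d$ and $t_1,\dots,t_k$ positive reals, and let $\mathcal{L}_\lambda(f;x_1,\dots,x_k,t_1,\dots,t_k)=\mathbb{E}\big[\exp\big(-\sum_{i=1}^k t_i\hat{\mathcal{I}}_\lambda(f;x_i)\big)\big]$ be the Laplace transform of $(\hat{\mathcal{I}}_\lambda(f;x_1),\dots,\hat{\mathcal{I}}_\lambda(f;x_k))$. Then $$\lim_{\lambda\to\infty}\mathcal{L}_\lambda(f;x_1,\dots,x_k,t_1,\dots,t_k)=\exp\Big(-\mathbb{E}[\mathbf{p}^{\alpha}]\,C(d,\beta)\sum_{i=1}^k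 t_i^{\alpha}\Big),$$ where $C(d,\beta)=\frac{\omega(d)}{\beta}\int_0^\infty(1-e^{-s})s^{-1-\alpha}\,ds$ and $\omega(d)$ is the surface area of the unit ball in $\mathbb{R}^d$.
   Context: An independently marked Poisson point process of intensity $\lambda$ on $\mathbb{R}^d$ is a marked point process $\{(x_i,\mathbf{p}_i)\}$ where $\{x_i\}$ is a homogeneous Poisson point process of intensity $\lambda$ with respect to Lebesgue measure, and the marks $\mathbf{p}_i\in(0,\infty)$ are i.i.d. with distribution $F$ and independent of $\{x_i\}$. $\mathbf{p}$ denotes a generic random variable with distribution $F$. *)

theory Defs
  imports "HOL-Probability.Probability"
begin

definition poisson_pp :: "'w measure \<Rightarrow> real \<Rightarrow> ('w \<Rightarrow> 'a::euclidean_space set) \<Rightarrow> bool" where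
  "poisson_pp M lam Phi \<longleftrightarrow> prob_space M \<and>
     (\<forall>B. B \<in> sets borel \<and> bounded B \<longrightarrow>
        (\<lambda>\<omega>. card (Phi \<omega> \<inter> B)) \<in> measurable M (count_space UNIV) \<and>
        (AE \<omega> in M. finite (Phi \<omega> \<inter> B)) \<and>
        (\<forall>n. measure M {\<omega> \<in> space M. card (Phi \<omega> \<inter> B) = n} =
              (lam * measure lborel B) ^ n / fact n * exp (- (lam * measure lborel B)))) \<and>
     (\<forall>(n::nat) Bs. (\<forall>i<n. Bs i \<in> sets borel \<and> bounded (Bs i)) \<and> disjoint_family_on Bs {..<n} \<longrightarrow>
        prob_space.indep_vars M (\<lambda>_. count_space UNIV) (\<lambda>i \<omega>. card (Phi \<omega> \<inter> Bs i)) {..<n})"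

definition indep_marked_ppp ::
  "'w measure \<Rightarrow> real \<Rightarrow> real measure \<Rightarrow> (nat \<Rightarrow> 'w \<Rightarrow> 'a::euclidean_space) \<Rightarrow> (nat \<Rightarrow> 'w \<Rightarrow> real) \<Rightarrow> bool" where
  "indep_marked_ppp M lam F X P \<longleftrightarrow>
     poisson_pp M lam (\<lambda>\<omega>. range (\<lambda>n. X n \<omega>)) \<and>
     (\<forall>\<omega>\<in>space M. inj (\<lambda>n. X n \<omega>)) \<and>
     (\<forall>n. X n \<in> borel_measurable M) \<and>
     (\<forall>n. P n \<in> borel_measurable M \<and> distr M borel (P n) = F) \<and>
     prob_space.indep_vars M (\<lambda>_. borel) P UNIV \<and>
     prob_space.indep_set M
       (sets (vimage_algebra (space M) (\<lambda>\<omega> n. P n \<omega>) (PiM UNIV (\<lambda>_. borel) :: (nat \<Rightarrow> real) measure)))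
       (sets (vimage_algebra (space M) (\<lambda>\<omega> n. X n \<omega>) (PiM UNIV (\<lambda>_. borel) :: (nat \<Rightarrow> 'a) measure)))"

definition interference ::
  "(real \<Rightarrow> ennreal) \<Rightarrow> (nat \<Rightarrow> 'w \<Rightarrow> 'a::euclidean_space) \<Rightarrow> (nat \<Rightarrow> 'w \<Rightarrow> real) \<Rightarrow> 'a \<Rightarrow> 'w \<Rightarrow> ennreal" where
  "interference f X P z \<omega> = (\<Sum>n. ennreal (P n \<omega>) * f (dist (X n \<omega>) z))"

definition exp_neg :: "ennreal \<Rightarrow> real" where
  "exp_neg x = (if x = \<top> then 0 else exp (- enn2real x))"

definition laplace_I ::
  "'w measure \<Rightarrow> real \<Rightarrow> real \<Rightarrow> (real \<Rightarrow> ennreal) \<Rightarrow> (nat \<Rightarrow> 'w \<Rightarrow> 'a::euclidean_space) \<Rightarrow> (nat \<Rightarrow> 'w \<Rightarrow> real)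
     \<Rightarrow> nat \<Rightarrow> (nat \<Rightarrow> 'a) \<Rightarrow> (nat \<Rightarrow> real) \<Rightarrow> real" where
  "laplace_I M lam kappa f X P k xs t =
     (\<integral>\<omega>. exp_neg (\<Sum>i<k. ennreal (t i) * (ennreal (lam powr (- kappa)) * interference f X P (xs i) \<omega>)) \<partial>M)"

definition unit_sphere_area :: "'a::euclidean_space itself \<Rightarrow> real" where
  "unit_sphere_area _ = real DIM('a) * measure lborel (ball (0::'a) 1)"

end

theory Submission
  imports Defs
begin

text \<open>
  By independence of the marks and the Laplace functional of a Poisson process, the Laplace transform
  equals $\exp(-q(\lambda))$ with
  $q(\lambda) = \lambda \int\!\!\int (1 - e^{-p \lambda^{-\kappa} \sum_i t_i f(|x - x_i|)})\,dx\,F(dp)$.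
  For the pure power law $f(r) = r^{-\beta}$ and a single point $x_i$, the radial substitution
  $s = p t_i \lambda^{-\kappa} r^{-\beta}$ makes this integral equal to its limit for every $\lambda$.
  In general, subadditivity of $1 - e^{-s}$ bounds $q(\lambda)$ from above by the sum of the one-point
  power-law integrals, and the disjointness of small balls around the $x_i$ bounds it from below,
  both up to the contribution of distances at least $\delta$. Since $1 - e^{-s} \le s$ and the mean mark is
  finite, that contribution is $O(\lambda^{1-\kappa})$, which vanishes because $\kappa > 1$.
\<close>

section \<open>The function \<open>exp_neg\<close>\<close>

text \<open>The kernel s^{-1-\<alpha>} and the constant C(d,\<beta>) have one source: the image of
  Lebesgue measure under x \<mapsto> c |x|^{-\<beta>} has density c^\<alpha> (\<omega>(d)/\<beta>)
  s^{-1-\<alpha>} on s > 0. The weight c enters only through c^\<alpha>, which for c = p t_i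
  \<lambda>^{-\<kappa>} equals p^\<alpha> t_i^\<alpha> / \<lambda>, since \<alpha>\<kappa> = 1. The
  normalisation is therefore exactly the one that cancels the intensity. Finiteness is the recurring
  obstacle: the interference is a series of unbounded terms, and the image measure has infinite mass
  near 0. Sums and exponents therefore live in \<open>ennreal\<close>, with \<open>exp_neg\<close>
  sending \<top> to 0. The Laplace functional then holds for every measurable kernel and limits pass
  through exponents unconditionally; finiteness is established only for the limit and the error
  terms. The marks are integrated out with the positions held fixed. This replaces a kernel g by
  u(g), where e^{-u(s)} is the mean of e^{-ps} under F, and leaves an unmarked Poisson
  process.\<close>

lemma exp_neg_ennreal: "0 \<le> x \<Longrightarrow> exp_neg (ennreal x) = exp (- x)"
  by (simp add: exp_neg_def)

lemma exp_neg_top [simp]: "exp_neg \<top> = 0"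
  by (simp add: exp_neg_def)

lemma exp_neg_0 [simp]: "exp_neg 0 = 1"
  by (simp add: exp_neg_def)

lemma exp_neg_nonneg [simp]: "0 \<le> exp_neg x"
  by (simp add: exp_neg_def)

lemma exp_neg_antimono: "x \<le> y \<Longrightarrow> exp_neg y \<le> exp_neg x"
  by (cases x; cases y) (auto simp: exp_neg_ennreal top_unique)

lemma exp_neg_le_1 [simp]: "exp_neg x \<le> 1"
  using exp_neg_antimono[of 0 x] by simp

lemma exp_neg_add: "exp_neg (x + y) = exp_neg x * exp_neg y"
  by (cases x; cases y)
     (simp_all add: exp_neg_ennreal flip: ennreal_plus exp_add)

lemma exp_neg_sum: "exp_neg (\<Sum>i\<in>A. g i) = (\<Prod>i\<in>A. exp_neg (g i))"
  by (induction A rule: infinite_finite_induct) (simp_all add: exp_neg_add)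

lemma one_minus_exp_neg_le: "ennreal (1 - exp_neg x) \<le> x"
proof (cases x)
  case (real r)
  have "1 - exp (- r) \<le> r"
    using exp_ge_add_one_self[of "- r"] by simp
  with real show ?thesis
    by (simp add: exp_neg_ennreal ennreal_leI)
qed simp

text \<open>Induction on the inequality 1 - ab \<le> (1 - a) + (1 - b) for a, b in [0,1], which is
  (1 - a)(1 - b) \<ge> 0 rearranged.\<close>

lemma one_minus_exp_neg_sum_le:
  "ennreal (1 - exp_neg (\<Sum>i\<in>A. g i)) \<le> (\<Sum>i\<in>A. ennreal (1 - exp_neg (g i)))"
proof (induction A rule: infinite_finite_induct)
  case (insert i A)
  have "1 - a * b \<le> (1 - a) + (1 - b)" if "0 \<le> a" "a \<le> 1" "0 \<le> b" "b \<le> 1" for a b :: real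
    using mult_nonneg_nonneg[of "1 - a" "1 - b"] that by (simp add: algebra_simps)
  then have "ennreal (1 - exp_neg (\<Sum>i\<in>insert i A. g i))
      \<le> ennreal ((1 - exp_neg (g i)) + (1 - exp_neg (\<Sum>i\<in>A. g i)))"
    using insert by (intro ennreal_leI) (simp add: exp_neg_add)
  also have "\<dots> = ennreal (1 - exp_neg (g i)) + ennreal (1 - exp_neg (\<Sum>i\<in>A. g i))"
    by (rule ennreal_plus) simp_all
  also have "\<dots> \<le> ennreal (1 - exp_neg (g i)) + (\<Sum>i\<in>A. ennreal (1 - exp_neg (g i)))"
    by (rule add_left_mono[OF insert.IH])
  finally show ?case
    by (simp add: insert.hyps del: sum_ennreal)
qed simp_all

text \<open>Continuity on all of \<open>ennreal\<close>, including at \<top>, so that limits of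
  exponents need no finiteness check.\<close>

lemma tendsto_exp_neg:
  assumes "(g \<longlongrightarrow> x) L"
  shows "((\<lambda>n. exp_neg (g n)) \<longlongrightarrow> exp_neg x) L"
proof (cases "x = \<top>")
  case False
  then have "((\<lambda>n. exp (- enn2real (g n))) \<longlongrightarrow> exp (- enn2real x)) L"
    using assms by (intro tendsto_intros) (auto simp: less_top)
  moreover have "\<forall>\<^sub>F n in L. g n < \<top>"
    using order_tendstoD(2)[OF assms] False by (auto simp: less_top)
  then have "\<forall>\<^sub>F n in L. exp (- enn2real (g n)) = exp_neg (g n)"
    by eventually_elim (auto simp: exp_neg_def)
  ultimately show ?thesis
    using False by (auto simp: exp_neg_def[of x] intro: Lim_transform_eventually)
next
  case True
  have "\<forall>\<^sub>F n in L. \<bar>exp_neg (g n)\<bar> < e" if "0 < e" for e :: real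
  proof -
    \<comment> \<open>Any \<open>r > - ln e\<close> gives \<open>exp (- r) < e\<close>; the maximum
      with 0 keeps \<open>r\<close> nonnegative, so that \<open>ennreal r\<close> does not truncate
      it.\<close>
    define r where "r = max 0 (- ln e) + 1"
    have "exp (- r) < exp (ln e)"
      by (simp add: r_def)
    moreover have "0 \<le> r"
      by (simp add: r_def)
    ultimately have r: "exp_neg (ennreal r) < e"
      using \<open>0 < e\<close> by (simp add: exp_neg_ennreal)
    have "\<forall>\<^sub>F n in L. ennreal r < g n"
      using order_tendstoD(1)[OF assms] True by auto
    then show ?thesis
    proof eventually_elim
      case (elim n)
      then show ?case
        using r exp_neg_antimono[of "ennreal r" "g n"] by (simp add: less_imp_le)
    qed
  qed
  then show ?thesis
    using True by (auto simp: tendsto_iff dist_real_def)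
qed

lemma measurable_exp_neg [measurable]: "exp_neg \<in> borel_measurable borel"
  unfolding exp_neg_def[abs_def] by measurable

lemma exp_neg_suminf: "(\<lambda>n. exp_neg (\<Sum>i<n. g i)) \<longlonglongrightarrow> exp_neg (\<Sum>i. g i)"
  by (rule tendsto_exp_neg) (rule summable_LIMSEQ, simp)

section \<open>Laplace functional of a Poisson process\<close>

text \<open>Splitting the integral over the level sets of \<open>N\<close> produces the exponential
  series of \<open>m * q\<close>, multiplied by \<open>exp (- m)\<close>.\<close>

lemma (in prob_space) poisson_pgf:
  assumes N [measurable]: "N \<in> measurable M (count_space UNIV)"
    and dist: "\<And>n. prob {\<omega> \<in> space M. N \<omega> = n} = m ^ n / fact n * exp (- m)"
    and "0 \<le> m" "0 \<le> q"
  shows "(\<integral>\<^sup>+\<omega>. ennreal (q ^ N \<omega>) \<partial>M) = ennreal (exp (- (m * (1 - q))))"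
proof -
  define A where "A n = {\<omega> \<in> space M. N \<omega> = n}" for n
  have [measurable]: "A n \<in> sets M" for n
    unfolding A_def by measurable
  have "(\<integral>\<^sup>+\<omega>. ennreal (q ^ N \<omega>) \<partial>M) = (\<integral>\<^sup>+\<omega>. (\<Sum>n. ennreal (q ^ n) * indicator (A n) \<omega>) \<partial>M)"
    by (intro nn_integral_cong suminf_cmult_indicator[symmetric])
       (auto simp: A_def disjoint_family_on_def)
  also have "\<dots> = (\<Sum>n. ennreal (q ^ n) * emeasure M (A n))"
    by (subst nn_integral_suminf) (simp_all add: nn_integral_cmult_indicator)
  also have "\<dots> = (\<Sum>n. ennreal (exp (- m) * ((m * q) ^ n / fact n)))"
    using \<open>0 \<le> m\<close> \<open>0 \<le> q\<close> unfolding emeasure_eq_measure A_def dist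
    by (intro suminf_cong) (simp add: power_mult_distrib ac_simps flip: ennreal_mult)
  also have "\<dots> = ennreal (exp (- m) * exp (m * q))"
    using sums_mult[OF exp_converges[of "m * q"], of "exp (- m)"] \<open>0 \<le> m\<close> \<open>0 \<le> q\<close>
    by (intro suminf_ennreal_eq) (simp_all add: divide_inverse ac_simps)
  also have "exp (- m) * exp (m * q) = exp (- (m * (1 - q)))"
    by (simp add: algebra_simps flip: exp_add)
  finally show ?thesis .
qed

text \<open>Bridges two views of the process: the interference sums over an enumeration of the
  points, while \<open>poisson_pp\<close> counts elements of a set. Injectivity excludes
  multiplicities, and finiteness matters because \<open>card\<close> of an infinite set is
  0.\<close>

lemma suminf_indicator_inj:
  fixes x :: "nat \<Rightarrow> 'a"
  assumes "inj x" "finite (range x \<inter> B)"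
  shows "(\<Sum>n. indicator B (x n) :: ennreal) = of_nat (card (range x \<inter> B))"
proof -
  have img: "range x \<inter> B = x ` (x -` B)"
    by auto
  have "finite (x -` B)"
    using assms img by (metis finite_imageD inj_on_subset subset_UNIV)
  then have "(\<Sum>n. indicator B (x n) :: ennreal) = (\<Sum>n\<in>x -` B. indicator B (x n))"
    by (intro suminf_finite) auto
  also have "\<dots> = of_nat (card (x -` B))"
    by simp
  also have "card (x -` B) = card (range x \<inter> B)"
    unfolding img by (rule card_image[symmetric]) (use assms in \<open>auto intro: inj_on_subset\<close>)
  finally show ?thesis .
qed

lemma exp_neg_mult_of_nat: "exp_neg (a * of_nat n) = exp_neg a ^ n"
  by (induction n) (simp_all add: distrib_left exp_neg_add)

text \<open>The counts in the level sets of \<open>u\<close> are independent Poisson variables, so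
  the integral factorises into generating functions evaluated at \<open>exp_neg\<close> of the
  values. Bounded support is assumed because \<open>poisson_pp\<close> speaks of bounded sets
  only.\<close>

lemma poisson_laplace_simple:
  fixes X :: "nat \<Rightarrow> 'w \<Rightarrow> 'a::euclidean_space"
  assumes pp: "poisson_pp M lam (\<lambda>\<omega>. range (\<lambda>n. X n \<omega>))" and "0 \<le> lam"
    and inj: "\<And>\<omega>. \<omega> \<in> space M \<Longrightarrow> inj (\<lambda>n. X n \<omega>)"
    and u: "simple_function borel u" and fin: "\<And>x. u x < \<top>" and bdd: "bounded {x. u x \<noteq> 0}"
  shows "(\<integral>\<^sup>+\<omega>. ennreal (exp_neg (\<Sum>n. u (X n \<omega>))) \<partial>M)
    = ennreal (exp_neg (ennreal lam * (\<integral>\<^sup>+x. ennreal (1 - exp_neg (u x)) \<partial>lborel)))"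
proof -
  interpret prob_space M
    using pp by (simp add: poisson_pp_def)
  \<comment> \<open>The level set of 0 is unbounded, but it contributes nothing to either
    side.\<close>
  define V where "V = range u - {0}"
  have "finite V"
    using u by (simp add: V_def simple_function_def)
  then obtain e where e: "bij_betw e {..<card V} V"
    using ex_bij_betw_nat_finite by (metis atLeast0LessThan)
  define m where "m = card V"
  define B where "B i = u -` {e i}" for i
  define N where "N i \<omega> = card (range (\<lambda>n. X n \<omega>) \<inter> B i)" for i \<omega>
  define q where "q i = exp_neg (e i)" for i
  have eV: "e i \<in> V" if "i < m" for i
    using e that by (auto simp: bij_betw_def m_def)
  have B [measurable]: "B i \<in> sets borel" for i
    using simple_functionD(2)[OF u, of "{e i}"] by (simp add: B_def)
  have bB: "bounded (B i)" if "i < m" for i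
    using bdd eV[OF that] by (auto simp: B_def V_def elim!: bounded_subset)
  have disj: "disjoint_family_on B {..<m}"
    using e by (auto simp: disjoint_family_on_def B_def bij_betw_def inj_on_def m_def)
  \<comment> \<open>Stated for general \<open>G\<close> because it is used twice: with the identity
    under the sum over points, and with \<open>1 - exp_neg\<close> under the Lebesgue integral. The
    condition \<open>G 0 = 0\<close> accounts for the omitted level set.\<close>
  have expand: "G (u x) = (\<Sum>i<m. G (e i) * indicator (B i) x)" if "G 0 = 0"
    for G :: "ennreal \<Rightarrow> ennreal" and x
  proof -
    have "(\<Sum>i<m. G (e i) * indicator (B i) x) = (\<Sum>v\<in>V. G v * indicator (u -` {v}) x)"
      unfolding m_def B_def by (rule sum.reindex_bij_betw[OF e])
    also have "\<dots> = (\<Sum>v\<in>V. if v = u x then G v else 0)"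
      by (intro sum.cong) (auto simp: indicator_def)
    also have "\<dots> = G (u x)"
      using \<open>finite V\<close> that by (auto simp: V_def)
    finally show ?thesis ..
  qed
  have N_props: "N i \<in> measurable M (count_space UNIV)"
     "AE \<omega> in M. finite (range (\<lambda>n. X n \<omega>) \<inter> B i)"
     "\<And>n. prob {\<omega> \<in> space M. N i \<omega> = n} =
       (lam * measure lborel (B i)) ^ n / fact n * exp (- (lam * measure lborel (B i)))"
    if "i < m" for i
    using pp bB[OF that] B[of i] unfolding poisson_pp_def N_def[abs_def] by blast+
  have ind: "indep_vars (\<lambda>_. count_space UNIV) N {..<m}"
    using pp bB B disj unfolding poisson_pp_def N_def[abs_def] by blast
  have Bfin: "emeasure lborel (B i) = ennreal (measure lborel (B i))" if "i < m" for i
    using emeasure_bounded_finite[OF bB[OF that]] by (simp add: emeasure_eq_ennreal_measure less_top)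

  have "AE \<omega> in M. \<forall>i<m. finite (range (\<lambda>n. X n \<omega>) \<inter> B i)"
    using N_props(2) by (simp add: AE_all_countable)
  then have "AE \<omega> in M. ennreal (exp_neg (\<Sum>n. u (X n \<omega>))) = (\<Prod>i<m. ennreal (q i ^ N i \<omega>))"
    using AE_space
  proof eventually_elim
    case (elim \<omega>)
    have "(\<Sum>n. u (X n \<omega>)) = (\<Sum>n. \<Sum>i<m. e i * indicator (B i) (X n \<omega>))"
      by (subst expand[of "\<lambda>x. x"]) auto
    also have "\<dots> = (\<Sum>i<m. e i * (\<Sum>n. indicator (B i) (X n \<omega>)))"
      by (subst suminf_sum) auto
    also have "\<dots> = (\<Sum>i<m. e i * of_nat (N i \<omega>))"
      unfolding N_def using elim inj by (intro sum.cong refl) (subst suminf_indicator_inj; auto)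
    finally show ?case
      by (simp add: exp_neg_sum exp_neg_mult_of_nat q_def prod_ennreal)
  qed
  then have "(\<integral>\<^sup>+\<omega>. ennreal (exp_neg (\<Sum>n. u (X n \<omega>))) \<partial>M) = (\<integral>\<^sup>+\<omega>. (\<Prod>i<m. ennreal (q i ^ N i \<omega>)) \<partial>M)"
    by (rule nn_integral_cong_AE)
  also have "\<dots> = (\<Prod>i<m. \<integral>\<^sup>+\<omega>. ennreal (q i ^ N i \<omega>) \<partial>M)"
    by (intro indep_vars_nn_integral indep_vars_compose2[OF ind, where Y="\<lambda>i n. ennreal (q i ^ n)"]) auto
  also have "\<dots> = (\<Prod>i<m. ennreal (exp (- (lam * measure lborel (B i) * (1 - q i)))))"
    using \<open>0 \<le> lam\<close> by (intro prod.cong refl poisson_pgf N_props) (auto simp: q_def)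
  also have "\<dots> = ennreal (\<Prod>i<m. exp_neg (ennreal lam * (ennreal (1 - exp_neg (e i)) * emeasure lborel (B i))))"
    using \<open>0 \<le> lam\<close>
    by (subst prod_ennreal) (auto simp: Bfin exp_neg_ennreal q_def ac_simps simp flip: ennreal_mult intro!: arg_cong[where f=ennreal] prod.cong)
  also have "\<dots> = ennreal (exp_neg (ennreal lam * (\<integral>\<^sup>+x. (\<Sum>i<m. ennreal (1 - exp_neg (e i)) * indicator (B i) x) \<partial>lborel)))"
    by (subst nn_integral_sum) (simp_all add: nn_integral_cmult_indicator exp_neg_sum sum_distrib_left)
  also have "(\<integral>\<^sup>+x. (\<Sum>i<m. ennreal (1 - exp_neg (e i)) * indicator (B i) x) \<partial>lborel)
      = (\<integral>\<^sup>+x. ennreal (1 - exp_neg (u x)) \<partial>lborel)"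
    by (subst expand[of "\<lambda>v. ennreal (1 - exp_neg v)"]) auto
  finally show ?thesis .
qed

text \<open>Approximation from below by simple functions of bounded support: the expectation
  converges by domination by 1, the integral in the exponent by monotone convergence.\<close>

lemma poisson_laplace_functional:
  fixes X :: "nat \<Rightarrow> 'w \<Rightarrow> 'a::euclidean_space"
  assumes pp: "poisson_pp M lam (\<lambda>\<omega>. range (\<lambda>n. X n \<omega>))" and "0 \<le> lam"
    and inj: "\<And>\<omega>. \<omega> \<in> space M \<Longrightarrow> inj (\<lambda>n. X n \<omega>)"
    and X [measurable]: "\<And>n. X n \<in> borel_measurable M"
    and u [measurable]: "u \<in> borel_measurable borel"
  shows "(\<integral>\<^sup>+\<omega>. ennreal (exp_neg (\<Sum>n. u (X n \<omega>))) \<partial>M)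
    = ennreal (exp_neg (ennreal lam * (\<integral>\<^sup>+x. ennreal (1 - exp_neg (u x)) \<partial>lborel)))"
proof -
  interpret prob_space M
    using pp by (simp add: poisson_pp_def)
  obtain s where s: "\<And>i. simple_function borel (s i)" "incseq s" "\<And>i x. s i x < \<top>" "\<And>x. (SUP i. s i x) = u x"
    using borel_measurable_implies_simple_function_sequence'[OF u] by blast
  \<comment> \<open>The cutoff to growing balls provides the bounded support that the simple case
    requires.\<close>
  define v where "v i x = s i x * indicator (cball 0 (real i)) x" for i x
  have v_simple: "simple_function borel (v i)" for i
    unfolding v_def using s(1) by (intro simple_function_mult simple_function_indicator) auto
  have [measurable]: "v i \<in> borel_measurable borel" for i
    using v_simple by (rule borel_measurable_simple_function)
  have v_fin: "v i x < \<top>" for i x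
    using s(3)[of i x] by (auto simp: v_def indicator_def)
  have v_bdd: "bounded {x. v i x \<noteq> 0}" for i
    by (rule bounded_subset[OF bounded_cball[of 0 "real i"]]) (auto simp: v_def indicator_def split: if_splits)
  have v_inc: "v i x \<le> v j x" if "i \<le> j" for i j x
    using that le_funD[OF incseqD[OF s(2) that], of x] by (auto simp: v_def indicator_def)
  have v_lim: "(\<lambda>i. v i x) \<longlonglongrightarrow> u x" for x
  proof -
    have "(\<lambda>i. s i x) \<longlonglongrightarrow> u x"
      using s(2) unfolding s(4)[symmetric] by (intro LIMSEQ_SUP) (auto simp: incseq_def le_fun_def)
    moreover have "\<forall>\<^sub>F i in sequentially. s i x = v i x"
      using eventually_ge_at_top[of "nat \<lceil>norm x\<rceil>"]
      by eventually_elim (auto simp: v_def indicator_def; linarith)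
    ultimately show ?thesis
      by (rule Lim_transform_eventually)
  qed
  have v_SUP: "(SUP i. v i x) = u x" for x
    using LIMSEQ_SUP[of "\<lambda>i. v i x"] v_lim[of x] v_inc by (intro LIMSEQ_unique) (auto simp: incseq_def)

  have sum_lim: "(\<lambda>i. \<Sum>n. v i (X n \<omega>)) \<longlonglongrightarrow> (\<Sum>n. u (X n \<omega>))" for \<omega>
  proof -
    have "(\<Sum>n. u (X n \<omega>)) = (SUP i. \<Sum>n. v i (X n \<omega>))"
      unfolding v_SUP[symmetric] by (rule ennreal_suminf_SUP_eq) (auto simp: incseq_def v_inc)
    then show ?thesis
      using v_inc by (auto intro!: LIMSEQ_SUP suminf_le simp: incseq_def)
  qed
  have "(\<lambda>i. \<integral>\<^sup>+\<omega>. ennreal (exp_neg (\<Sum>n. v i (X n \<omega>))) \<partial>M) \<longlonglongrightarrow> (\<integral>\<^sup>+\<omega>. ennreal (exp_neg (\<Sum>n. u (X n \<omega>))) \<partial>M)"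
    by (rule nn_integral_dominated_convergence[where w="\<lambda>_. 1"])
       (auto intro!: tendsto_ennrealI tendsto_exp_neg sum_lim simp: emeasure_space_1)
  moreover have "(\<lambda>i. \<integral>\<^sup>+x. ennreal (1 - exp_neg (v i x)) \<partial>lborel) \<longlonglongrightarrow> (\<integral>\<^sup>+x. ennreal (1 - exp_neg (u x)) \<partial>lborel)"
    by (rule nn_integral_LIMSEQ)
       (auto intro!: tendsto_intros tendsto_exp_neg v_lim ennreal_leI exp_neg_antimono v_inc simp: incseq_def le_fun_def)
  then have "(\<lambda>i. ennreal (exp_neg (ennreal lam * (\<integral>\<^sup>+x. ennreal (1 - exp_neg (v i x)) \<partial>lborel))))
     \<longlonglongrightarrow> ennreal (exp_neg (ennreal lam * (\<integral>\<^sup>+x. ennreal (1 - exp_neg (u x)) \<partial>lborel)))"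
    by (intro tendsto_ennrealI tendsto_exp_neg ennreal_tendsto_cmult) auto
  moreover have "(\<integral>\<^sup>+\<omega>. ennreal (exp_neg (\<Sum>n. v i (X n \<omega>))) \<partial>M)
      = ennreal (exp_neg (ennreal lam * (\<integral>\<^sup>+x. ennreal (1 - exp_neg (v i x)) \<partial>lborel)))" for i
    using pp \<open>0 \<le> lam\<close> inj v_simple v_fin v_bdd by (rule poisson_laplace_simple)
  ultimately show ?thesis
    by (simp only: LIMSEQ_unique)
qed

section \<open>Independent marks\<close>

text \<open>Here \<open>u\<close> is the negative logarithm of the Laplace transform of
  \<open>F\<close>, and the weights \<open>c n\<close> are deterministic: they stand for kernel
  values at fixed positions. Independence factorises the partial sums, and domination by 1 gives the
  series.\<close>

lemma (in prob_space) laplace_weighted_iid_sum: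
  assumes ind: "indep_vars (\<lambda>_. borel) P UNIV" and F: "\<And>n. distr M borel (P n) = F"
    and u: "\<And>s. (\<integral>\<^sup>+p. ennreal (exp_neg (ennreal p * s)) \<partial>F) = ennreal (exp_neg (u s))"
  shows "(\<integral>\<^sup>+\<omega>. ennreal (exp_neg (\<Sum>n. ennreal (P n \<omega>) * c n)) \<partial>M) = ennreal (exp_neg (\<Sum>n. u (c n)))"
proof -
  have P [measurable]: "P n \<in> borel_measurable M" for n
    using ind by (auto simp: indep_vars_def)
  have fin: "(\<integral>\<^sup>+\<omega>. ennreal (exp_neg (\<Sum>n<m. ennreal (P n \<omega>) * c n)) \<partial>M) = ennreal (exp_neg (\<Sum>n<m. u (c n)))" for m
  proof -
    have "(\<integral>\<^sup>+\<omega>. ennreal (exp_neg (\<Sum>n<m. ennreal (P n \<omega>) * c n)) \<partial>M)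
        = (\<integral>\<^sup>+\<omega>. (\<Prod>n<m. ennreal (exp_neg (ennreal (P n \<omega>) * c n))) \<partial>M)"
      by (simp add: exp_neg_sum prod_ennreal)
    also have "\<dots> = (\<Prod>n<m. \<integral>\<^sup>+\<omega>. ennreal (exp_neg (ennreal (P n \<omega>) * c n)) \<partial>M)"
      by (intro indep_vars_nn_integral
            indep_vars_compose2[OF indep_vars_subset[OF ind], where Y="\<lambda>n p. ennreal (exp_neg (ennreal p * c n))"]) auto
    also have "\<dots> = (\<Prod>n<m. \<integral>\<^sup>+p. ennreal (exp_neg (ennreal p * c n)) \<partial>F)"
      by (intro prod.cong refl) (subst F[symmetric], subst nn_integral_distr, auto)
    also have "\<dots> = ennreal (exp_neg (\<Sum>n<m. u (c n)))"
      by (simp add: u exp_neg_sum prod_ennreal)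
    finally show ?thesis .
  qed
  have "(\<lambda>m. \<integral>\<^sup>+\<omega>. ennreal (exp_neg (\<Sum>n<m. ennreal (P n \<omega>) * c n)) \<partial>M)
      \<longlonglongrightarrow> (\<integral>\<^sup>+\<omega>. ennreal (exp_neg (\<Sum>n. ennreal (P n \<omega>) * c n)) \<partial>M)"
    by (rule nn_integral_dominated_convergence[where w="\<lambda>_. 1"])
       (auto intro!: tendsto_ennrealI exp_neg_suminf simp: emeasure_space_1)
  moreover have "(\<lambda>m. ennreal (exp_neg (\<Sum>n<m. u (c n)))) \<longlonglongrightarrow> ennreal (exp_neg (\<Sum>n. u (c n)))"
    by (intro tendsto_ennrealI exp_neg_suminf)
  ultimately show ?thesis
    unfolding fin by (rule LIMSEQ_unique)
qed

lemma exp_neg_minus_ln: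
  assumes "0 \<le> x" "x \<le> 1"
  shows "exp_neg (if x = 0 then \<top> else ennreal (- ln x)) = x"
  using assms by (auto simp: exp_neg_ennreal)

text \<open>Independence of the two generated \<sigma>-algebras is the product formula on
  rectangles, and rectangles determine the product measure. This makes Tonelli available for marks
  against positions.\<close>

lemma (in prob_space) indep_set_vimage_joint_distr:
  assumes X [measurable]: "X \<in> measurable M S" and Y [measurable]: "Y \<in> measurable M T"
    and ind: "indep_set (sets (vimage_algebra (space M) X S)) (sets (vimage_algebra (space M) Y T))"
  shows "distr M S X \<Otimes>\<^sub>M distr M T Y = distr M (S \<Otimes>\<^sub>M T) (\<lambda>\<omega>. (X \<omega>, Y \<omega>))"
proof (rule pair_measure_eqI)
  show "sigma_finite_measure (distr M S X)" "sigma_finite_measure (distr M T Y)"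
    by (auto intro!: prob_space_imp_sigma_finite prob_space_distr)
  show "sets (distr M S X \<Otimes>\<^sub>M distr M T Y) = sets (distr M (S \<Otimes>\<^sub>M T) (\<lambda>\<omega>. (X \<omega>, Y \<omega>)))"
    by (simp cong: sets_pair_measure_cong)
  fix A B assume "A \<in> sets (distr M S X)" "B \<in> sets (distr M T Y)"
  then have [measurable]: "A \<in> sets S" "B \<in> sets T"
    by auto
  have "(\<lambda>\<omega>. (X \<omega>, Y \<omega>)) -` (A \<times> B) \<inter> space M = (X -` A \<inter> space M) \<inter> (Y -` B \<inter> space M)"
    by auto
  moreover have "prob ((X -` A \<inter> space M) \<inter> (Y -` B \<inter> space M)) = prob (X -` A \<inter> space M) * prob (Y -` B \<inter> space M)"
    by (rule indep_setD[OF ind]) (auto intro: in_vimage_algebra)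
  ultimately show "emeasure (distr M S X) A * emeasure (distr M T Y) B = emeasure (distr M (S \<Otimes>\<^sub>M T) (\<lambda>\<omega>. (X \<omega>, Y \<omega>))) (A \<times> B)"
    by (simp add: emeasure_distr emeasure_eq_measure flip: ennreal_mult)
qed

text \<open>Given the positions, averaging over the marks turns the weighted sum into the sum of
  \<open>u (g (X n \<omega>))\<close>; the unmarked functional then applies to the composed
  kernel.\<close>

lemma marked_poisson_laplace_functional:
  fixes X :: "nat \<Rightarrow> 'w \<Rightarrow> 'a::euclidean_space"
  assumes proc: "indep_marked_ppp M lam F X P" and "0 \<le> lam"
    and g [measurable]: "g \<in> borel_measurable borel"
  shows "(\<integral>\<^sup>+\<omega>. ennreal (exp_neg (\<Sum>n. ennreal (P n \<omega>) * g (X n \<omega>))) \<partial>M)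
    = ennreal (exp_neg (ennreal lam * (\<integral>\<^sup>+x. \<integral>\<^sup>+p. ennreal (1 - exp_neg (ennreal p * g x)) \<partial>F \<partial>lborel)))"
proof -
  let ?PP = "PiM UNIV (\<lambda>_. borel) :: (nat \<Rightarrow> real) measure"
  let ?PX = "PiM UNIV (\<lambda>_. borel) :: (nat \<Rightarrow> 'a) measure"
  let ?P = "\<lambda>\<omega> n. P n \<omega>" and ?X = "\<lambda>\<omega> n. X n \<omega>"
  have pp: "poisson_pp M lam (\<lambda>\<omega>. range (\<lambda>n. X n \<omega>))"
    and inj: "\<And>\<omega>. \<omega> \<in> space M \<Longrightarrow> inj (\<lambda>n. X n \<omega>)"
    and X [measurable]: "\<And>n. X n \<in> borel_measurable M"
    and P [measurable]: "\<And>n. P n \<in> borel_measurable M"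
    and F: "\<And>n. distr M borel (P n) = F"
    and ind: "prob_space.indep_vars M (\<lambda>_. borel) P UNIV"
    and ind_PX: "prob_space.indep_set M (sets (vimage_algebra (space M) ?P ?PP)) (sets (vimage_algebra (space M) ?X ?PX))"
    using proc unfolding indep_marked_ppp_def by auto
  interpret prob_space M
    using pp by (simp add: poisson_pp_def)
  interpret F: prob_space F
    unfolding F[of 0, symmetric] by (rule prob_space_distr) simp
  have [measurable_cong]: "sets F = sets borel"
    unfolding F[of 0, symmetric] by simp
  define h where "h s = (\<integral>p. exp_neg (ennreal p * s) \<partial>F)" for s
  \<comment> \<open>The case distinction makes \<open>exp_neg (u s) = h s\<close> hold also where
    \<open>h s = 0\<close>, which forces the exponent \<top>.\<close>
  define u where "u s = (if h s = 0 then \<top> else ennreal (- ln (h s)))" for s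
  have [measurable]: "h \<in> borel_measurable borel"
    unfolding h_def by measurable
  have [measurable]: "u \<in> borel_measurable borel"
    unfolding u_def by measurable
  have int: "integrable F (\<lambda>p. exp_neg (ennreal p * s))" for s
    by (rule F.integrable_const_bound[where B=1]) auto
  have h_le: "h s \<le> 1" for s
    unfolding h_def using int by (intro F.integral_le_const) auto
  have h_nonneg: "0 \<le> h s" for s
    unfolding h_def by (rule Bochner_Integration.integral_nonneg) simp
  have eu: "exp_neg (u s) = h s" for s
    unfolding u_def by (rule exp_neg_minus_ln[OF h_nonneg h_le])
  have h: "(\<integral>\<^sup>+p. ennreal (exp_neg (ennreal p * s)) \<partial>F) = ennreal (exp_neg (u s))" for s
    unfolding eu h_def by (rule nn_integral_eq_integral[OF int]) simp
  \<comment> \<open>Eliminates the auxiliary \<open>u\<close> at the end: integrating against the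
    probability measure \<open>F\<close> commutes with the complement to 1.\<close>
  have h': "(\<integral>\<^sup>+p. ennreal (1 - exp_neg (ennreal p * s)) \<partial>F) = ennreal (1 - exp_neg (u s))" for s
  proof -
    have "(\<integral>\<^sup>+p. ennreal (1 - exp_neg (ennreal p * s)) \<partial>F) = ennreal (\<integral>p. 1 - exp_neg (ennreal p * s) \<partial>F)"
      using int by (intro nn_integral_eq_integral) auto
    also have "(\<integral>p. 1 - exp_neg (ennreal p * s) \<partial>F) = 1 - exp_neg (u s)"
      unfolding eu h_def using int by (subst Bochner_Integration.integral_diff) (auto simp: F.prob_space)
    finally show ?thesis .
  qed

  have mP [measurable]: "?P \<in> measurable M ?PP" and mX [measurable]: "?X \<in> measurable M ?PX"
    by (rule measurable_PiM_single'; simp)+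
  note joint = indep_set_vimage_joint_distr[OF mP mX ind_PX]
  interpret DP: prob_space "distr M ?PP ?P"
    by (rule prob_space_distr) simp
  interpret DX: prob_space "distr M ?PX ?X"
    by (rule prob_space_distr) simp
  interpret D: pair_sigma_finite "distr M ?PP ?P" "distr M ?PX ?X" ..

  define G where "G = (\<lambda>(p, x). ennreal (exp_neg (\<Sum>n. ennreal (p n) * g (x n))))"
  have [measurable]: "G \<in> borel_measurable (?PP \<Otimes>\<^sub>M ?PX)"
    unfolding G_def by measurable
  have "(\<integral>\<^sup>+\<omega>. ennreal (exp_neg (\<Sum>n. ennreal (P n \<omega>) * g (X n \<omega>))) \<partial>M)
      = (\<integral>\<^sup>+z. G z \<partial>distr M (?PP \<Otimes>\<^sub>M ?PX) (\<lambda>\<omega>. (?P \<omega>, ?X \<omega>)))"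
    by (subst nn_integral_distr) (simp_all add: G_def)
  \<comment> \<open>The positions form the outer integral, so the inner one sees them as constant
    weights.\<close>
  also have "\<dots> = (\<integral>\<^sup>+x. \<integral>\<^sup>+p. G (p, x) \<partial>distr M ?PP ?P \<partial>distr M ?PX ?X)"
    unfolding joint[symmetric] by (subst D.nn_integral_snd) simp_all
  also have "\<dots> = (\<integral>\<^sup>+x. ennreal (exp_neg (\<Sum>n. u (g (x n)))) \<partial>distr M ?PX ?X)"
  proof (rule nn_integral_cong)
    fix x
    have "(\<integral>\<^sup>+p. G (p, x) \<partial>distr M ?PP ?P) = (\<integral>\<^sup>+\<omega>. ennreal (exp_neg (\<Sum>n. ennreal (P n \<omega>) * g (x n))) \<partial>M)"
      unfolding G_def by (subst nn_integral_distr) simp_all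
    also have "\<dots> = ennreal (exp_neg (\<Sum>n. u (g (x n))))"
      by (rule laplace_weighted_iid_sum[OF ind F h])
    finally show "(\<integral>\<^sup>+p. G (p, x) \<partial>distr M ?PP ?P) = ennreal (exp_neg (\<Sum>n. u (g (x n))))" .
  qed
  also have "\<dots> = (\<integral>\<^sup>+\<omega>. ennreal (exp_neg (\<Sum>n. u (g (X n \<omega>)))) \<partial>M)"
    by (subst nn_integral_distr) simp_all
  also have "\<dots> = ennreal (exp_neg (ennreal lam * (\<integral>\<^sup>+x. ennreal (1 - exp_neg (u (g x))) \<partial>lborel)))"
    using poisson_laplace_functional[OF pp \<open>0 \<le> lam\<close> inj X, of "\<lambda>x. u (g x)"] by simp
  finally show ?thesis
    unfolding h' .
qed

section \<open>Radial integrals\<close>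

text \<open>The measures compared below can have infinite mass near 0 or near infinity, so
  finiteness is asked only on intervals bounded away from both. The measures are identified on each
  window \<open>I n\<close>, and the windows exhaust the positive half-line.\<close>

lemma measure_eqI_pos_intervals:
  fixes M N :: "real measure"
  assumes sets: "sets M = sets borel" "sets N = sets borel"
    and null: "emeasure M {..0} = 0" "emeasure N {..0} = 0"
    and eq: "\<And>a b. 0 < a \<Longrightarrow> a \<le> b \<Longrightarrow> emeasure M {a<..b} = emeasure N {a<..b}"
    and fin: "\<And>a b. 0 < a \<Longrightarrow> a \<le> b \<Longrightarrow> emeasure M {a<..b} < \<infinity>"
  shows "M = N"
proof (rule measure_eqI)
  note [measurable_cong] = sets
  fix A assume "A \<in> sets M"
  then have [measurable]: "A \<in> sets borel"
    using sets by simp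
  define I where "I n = {inverse (real (Suc n))<..real (Suc n)}" for n
  have I: "inverse (real (Suc n)) \<le> real (Suc n)" for n
    by (simp add: field_simps)
  \<comment> \<open>The outer maximum in the right endpoint keeps it at least the left one, so that
    even an empty intersection has the form required by \<open>eq\<close> and
    \<open>fin\<close>.\<close>
  have tail: "I n \<inter> {x<..} = {max x (inverse (real (Suc n)))<..max (real (Suc n)) (max x (inverse (real (Suc n))))}" for n x
    using I[of n] by (auto simp: I_def max_def)
  have dens: "density M (indicator (I n)) = density N (indicator (I n))" for n
  proof (rule measure_eqI_lessThan)
    have D: "emeasure (density L (indicator (I n))) {x<..} = emeasure L (I n \<inter> {x<..})"
      if "sets L = sets borel" for L x
      using that by (subst emeasure_density)
        (auto simp: I_def nn_integral_indicator[symmetric] measurable_cong_sets[OF that refl] indicator_inter_arith simp del: nn_integral_indicator intro!: nn_integral_cong)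
    show "emeasure (density M (indicator (I n))) {x<..} < \<infinity>" for x
      unfolding D[OF sets(1)] tail by (rule fin) (auto simp: less_max_iff_disj)
    show "emeasure (density M (indicator (I n))) {x<..} = emeasure (density N (indicator (I n))) {x<..}" for x
      unfolding D[OF sets(1)] D[OF sets(2)] tail by (rule eq) (auto simp: less_max_iff_disj)
  qed (simp_all add: sets)
  have "incseq I"
  proof (rule incseq_SucI)
    fix n
    have "inverse (real (Suc (Suc n))) \<le> inverse (real (Suc n))"
      by (simp add: field_simps)
    then show "I n \<le> I (Suc n)"
      by (simp add: I_def Ioc_subset_iff)
  qed
  have UN: "(\<Union>n. A \<inter> I n) = A \<inter> {0<..}"
  proof -
    have "\<exists>n. x \<in> I n" if "0 < x" for x
    proof -
      obtain k where k: "inverse (real (Suc k)) < x"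
        using reals_Archimedean[OF \<open>0 < x\<close>] by auto
      obtain l where l: "x < real l"
        using reals_Archimedean2 by blast
      have "inverse (real (Suc (max k l))) \<le> inverse (real (Suc k))"
        by (simp add: field_simps)
      then have "inverse (real (Suc (max k l))) < x"
        using k by (rule le_less_trans)
      then have "x \<in> I (max k l)"
        using l by (simp add: I_def)
      then show ?thesis ..
    qed
    moreover have "0 < x" if "x \<in> I n" for x n
      using that by (auto simp: I_def intro: order.strict_trans[rotated])
    ultimately show ?thesis
      by auto
  qed
  have lim: "(\<lambda>n. emeasure (density L (indicator (I n))) A) \<longlonglongrightarrow> emeasure L A"
    if [measurable_cong]: "sets L = sets borel" and "emeasure L {..0} = 0" for L :: "real measure"
  proof -
    have "emeasure (density L (indicator (I n))) A = emeasure L (A \<inter> I n)" for n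
      using that by (subst emeasure_density)
        (auto simp: I_def nn_integral_indicator[symmetric] indicator_inter_arith mult.commute simp del: nn_integral_indicator intro!: nn_integral_cong)
    moreover have "(\<lambda>n. emeasure L (A \<inter> I n)) \<longlonglongrightarrow> emeasure L (A \<inter> {0<..})"
      unfolding UN[symmetric] using \<open>incseq I\<close> that(1)
      by (intro Lim_emeasure_incseq) (auto simp: incseq_def I_def)
    moreover have "emeasure L (A \<inter> {0<..}) = emeasure L A"
    proof (rule emeasure_eq_AE)
      have "{..0} \<in> null_sets L"
        using that by (auto simp: null_sets_def)
      then show "AE x in L. x \<in> A \<inter> {0<..} \<longleftrightarrow> x \<in> A"
        by (rule eventually_mono[OF AE_not_in]) auto
    qed (use that in auto)
    ultimately show ?thesis
      by simp
  qed
  show "emeasure M A = emeasure N A"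
    using lim[OF sets(1) null(1)] lim[OF sets(2) null(2)] unfolding dens by (rule LIMSEQ_unique)
qed (simp add: sets)

lemma nn_integral_FTC_Ioc:
  fixes f F :: "real \<Rightarrow> real"
  assumes "f \<in> borel_measurable borel"
    and "\<And>x. a \<le> x \<Longrightarrow> x \<le> b \<Longrightarrow> DERIV F x :> f x" "\<And>x. a \<le> x \<Longrightarrow> x \<le> b \<Longrightarrow> 0 \<le> f x" "a \<le> b"
  shows "(\<integral>\<^sup>+x. ennreal (f x) * indicator {a<..b} x \<partial>lborel) = ennreal (F b - F a)"
proof -
  have "(\<integral>\<^sup>+x. ennreal (f x) * indicator {a<..b} x \<partial>lborel) = (\<integral>\<^sup>+x. ennreal (f x) * indicator {a..b} x \<partial>lborel)"
    by (rule nn_integral_cong_AE, rule eventually_mono[OF AE_lborel_singleton[of a]]) (auto simp: indicator_def)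
  also have "\<dots> = ennreal (F b - F a)"
    using assms by (intro nn_integral_FTC_Icc) auto
  finally show ?thesis .
qed

text \<open>Polar coordinates for radial functions, read off from the volumes of spherical shells: V
  (b^d - a^d) is the integral of d V r^{d-1} over (a,b], and d V is the surface area.\<close>

lemma distr_norm_lborel:
  "distr lborel borel (norm :: 'a::euclidean_space \<Rightarrow> real)
    = density lborel (\<lambda>r. ennreal (unit_sphere_area TYPE('a) * r ^ (DIM('a) - 1)) * indicator {0<..} r)"
    (is "?D = density lborel ?d")
proof (rule measure_eqI_pos_intervals)
  let ?V = "unit_ball_vol (real DIM('a))"
  have area: "unit_sphere_area TYPE('a) = real DIM('a) * ?V"
    by (simp add: unit_sphere_area_def content_ball)
  have "norm -` {..0} = {0::'a}"
    by auto
  then show "emeasure ?D {..0} = 0"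
    by (subst emeasure_distr) auto
  have "emeasure (density lborel ?d) {..0} = (\<integral>\<^sup>+r. ?d r * indicator {..0} r \<partial>lborel)"
    by (rule emeasure_density) auto
  also have "\<dots> = (\<integral>\<^sup>+r. 0 \<partial>(lborel::real measure))"
    by (intro nn_integral_cong) (auto simp: indicator_def)
  finally show "emeasure (density lborel ?d) {..0} = 0"
    by simp
  fix a b :: real assume ab: "0 < a" "a \<le> b"
  have "norm -` {a<..b} = cball (0::'a) b - cball 0 a"
    by auto
  then have "emeasure ?D {a<..b} = emeasure lborel (cball (0::'a) b - cball 0 a)"
    by (subst emeasure_distr) auto
  also have "\<dots> = ennreal (?V * b ^ DIM('a)) - ennreal (?V * a ^ DIM('a))"
    using ab by (subst emeasure_Diff) (auto simp: emeasure_cball intro!: subset_cball)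
  also have "\<dots> = ennreal (?V * b ^ DIM('a) - ?V * a ^ DIM('a))"
    using ab by (intro ennreal_minus) auto
  finally have D: "emeasure ?D {a<..b} = ennreal (?V * b ^ DIM('a) - ?V * a ^ DIM('a))" .
  then show "emeasure ?D {a<..b} < \<infinity>"
    by simp
  have "emeasure (density lborel ?d) {a<..b} = (\<integral>\<^sup>+r. ?d r * indicator {a<..b} r \<partial>lborel)"
    by (rule emeasure_density) auto
  also have "\<dots> = (\<integral>\<^sup>+r. ennreal (unit_sphere_area TYPE('a) * r ^ (DIM('a) - 1)) * indicator {a<..b} r \<partial>lborel)"
    using ab by (intro nn_integral_cong) (auto simp: indicator_def)
  also have "\<dots> = ennreal (?V * b ^ DIM('a) - ?V * a ^ DIM('a))"
    using ab unfolding area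
    by (intro nn_integral_FTC_Ioc) (auto intro!: derivative_eq_intros)
  finally show "emeasure ?D {a<..b} = emeasure (density lborel ?d) {a<..b}"
    using D by simp
qed auto

lemma powr_inverse_less_iff:
  fixes x z :: real
  assumes "0 < x" "0 < z" "0 < b"
  shows "x < z powr (1 / b) \<longleftrightarrow> x powr b < z"
  using assms powr_less_cancel2[of b x "z powr (1 / b)"] powr_less_mono2[of b x "z powr (1 / b)"]
  by (auto simp: powr_powr)

text \<open>The preimage of (a,b] is, up to the origin, a shell between the radii (c/b)^{1/\<beta>}
  and (c/a)^{1/\<beta>}. Its volume V c^\<alpha> (a^{-\<alpha>} - b^{-\<alpha>}) is the increment of
  \<open>?G\<close>, an antiderivative of the claimed density.\<close>

lemma distr_norm_powr_lborel:
  fixes c beta :: real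
  assumes "0 < c" "0 < beta"
  defines "alpha \<equiv> real DIM('a) / beta"
  shows "distr lborel borel (\<lambda>y :: 'a::euclidean_space. c * norm y powr (- beta))
    = density lborel (\<lambda>s. ennreal (c powr alpha * (unit_sphere_area TYPE('a) / beta) * s powr (- 1 - alpha)) * indicator {0<..} s)"
    (is "?D = density lborel ?d")
proof (rule measure_eqI_pos_intervals)
  let ?V = "unit_ball_vol (real DIM('a))"
  let ?G = "\<lambda>s. - (?V * c powr alpha * s powr (- alpha))"
  have area: "unit_sphere_area TYPE('a) = real DIM('a) * ?V"
    by (simp add: unit_sphere_area_def content_ball)
  \<comment> \<open>In HOL \<open>0 powr (- beta)\<close> is 0, so the origin is sent to 0 instead
    of infinity. It is a null set, but it has to be removed from the ball in \<open>iff\<close>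
    below.\<close>
  have "(\<lambda>y::'a. c * norm y powr (- beta)) -` {..0} = {0}"
    using \<open>0 < c\<close> by (auto simp: mult_le_0_iff not_le)
  then show "emeasure ?D {..0} = 0"
    by (subst emeasure_distr) auto
  have "emeasure (density lborel ?d) {..0} = (\<integral>\<^sup>+r. ?d r * indicator {..0} r \<partial>lborel)"
    by (rule emeasure_density) auto
  also have "\<dots> = (\<integral>\<^sup>+r. 0 \<partial>(lborel::real measure))"
    by (intro nn_integral_cong) (auto simp: indicator_def)
  finally show "emeasure (density lborel ?d) {..0} = 0"
    by simp
  fix a b :: real assume ab: "0 < a" "a \<le> b"
  let ?r = "\<lambda>a. (c / a) powr (1 / beta)"
  have iff: "a < c * norm y powr (- beta) \<longleftrightarrow> y \<in> ball 0 (?r a) - {0}" if "0 < a" for a and y :: 'a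
  proof (cases "y = 0")
    case False
    then have "norm y < ?r a \<longleftrightarrow> norm y powr beta < c / a"
      using assms that by (intro powr_inverse_less_iff) auto
    also have "\<dots> \<longleftrightarrow> a < c * norm y powr (- beta)"
      using False that by (simp add: powr_minus field_simps)
    finally show ?thesis
      using False by simp
  qed (use that in simp)
  have pre: "(\<lambda>y::'a. c * norm y powr (- beta)) -` {a<..b} = (ball 0 (?r a) - ball 0 (?r b)) - {0}"
    using iff[of a] iff[of b] ab by (auto simp: not_less[symmetric] simp del: mem_ball)
  have "emeasure ?D {a<..b} = emeasure lborel ((ball (0::'a) (?r a) - ball 0 (?r b)) - {0})"
    unfolding pre[symmetric] by (subst emeasure_distr) auto
  also have "\<dots> = emeasure lborel (ball (0::'a) (?r a) - ball 0 (?r b))"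
    by (rule emeasure_Diff_null_set) auto
  also have "\<dots> = ennreal (?V * ?r a ^ DIM('a)) - ennreal (?V * ?r b ^ DIM('a))"
    using ab assms by (subst emeasure_Diff) (auto simp: emeasure_ball frac_le intro!: subset_ball powr_mono2)
  also have "\<dots> = ennreal (?V * ?r a ^ DIM('a) - ?V * ?r b ^ DIM('a))"
    using ab by (intro ennreal_minus) auto
  also have "?V * ?r a ^ DIM('a) - ?V * ?r b ^ DIM('a) = ?G b - ?G a"
    using ab assms by (simp add: powr_powr powr_divide powr_minus field_simps alpha_def flip: powr_realpow)
  finally have D: "emeasure ?D {a<..b} = ennreal (?G b - ?G a)" .
  then show "emeasure ?D {a<..b} < \<infinity>"
    by simp
  have "emeasure (density lborel ?d) {a<..b} = (\<integral>\<^sup>+r. ?d r * indicator {a<..b} r \<partial>lborel)"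
    by (rule emeasure_density) auto
  also have "\<dots> = (\<integral>\<^sup>+s. ennreal (c powr alpha * (unit_sphere_area TYPE('a) / beta) * s powr (- 1 - alpha)) * indicator {a<..b} s \<partial>lborel)"
    using ab by (intro nn_integral_cong) (auto simp: indicator_def)
  also have "\<dots> = ennreal (?G b - ?G a)"
    using ab assms(1,2) unfolding area
    by (intro nn_integral_FTC_Ioc) (auto intro!: derivative_eq_intros simp: alpha_def algebra_simps minus_diff_commute)
  finally show "emeasure ?D {a<..b} = emeasure (density lborel ?d) {a<..b}"
    using D by simp
qed auto

lemma nn_integral_lborel_shift:
  fixes z :: "'a::euclidean_space"
  assumes [measurable]: "h \<in> borel_measurable borel"
  shows "(\<integral>\<^sup>+x. h (x - z) \<partial>lborel) = (\<integral>\<^sup>+x. h x \<partial>lborel)"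
proof -
  have "(\<integral>\<^sup>+x. h x \<partial>lborel) = (\<integral>\<^sup>+x. h x \<partial>distr lborel borel ((+) (- z)))"
    by (simp only: lborel_distr_plus)
  also have "\<dots> = (\<integral>\<^sup>+x. h (x - z) \<partial>lborel)"
    by (subst nn_integral_distr) simp_all
  finally show ?thesis ..
qed

lemma nn_integral_radial:
  fixes h :: "real \<Rightarrow> ennreal"
  assumes [measurable]: "h \<in> borel_measurable borel"
  shows "(\<integral>\<^sup>+x. h (norm (x :: 'a::euclidean_space)) \<partial>lborel)
    = ennreal (unit_sphere_area TYPE('a)) * (\<integral>\<^sup>+r. ennreal (r ^ (DIM('a) - 1)) * h r * indicator {0<..} r \<partial>lborel)"
proof -
  have "0 \<le> unit_sphere_area TYPE('a)"
    by (simp add: unit_sphere_area_def)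
  have radial: "(\<integral>\<^sup>+x. h (norm (x :: 'a)) \<partial>lborel) = (\<integral>\<^sup>+r. h r \<partial>distr lborel borel (norm :: 'a \<Rightarrow> real))"
    by (subst nn_integral_distr) simp_all
  from \<open>0 \<le> _\<close> have "(\<integral>\<^sup>+x. h (norm (x :: 'a)) \<partial>lborel) = (\<integral>\<^sup>+r. ennreal (unit_sphere_area TYPE('a)) * (ennreal (r ^ (DIM('a) - 1)) * h r * indicator {0<..} r) \<partial>lborel)"
    unfolding radial
    by (auto simp: distr_norm_lborel nn_integral_density indicator_def ennreal_mult ac_simps intro!: nn_integral_cong)
  then show ?thesis
    by (simp add: nn_integral_cmult)
qed

text \<open>Change of variables along the image measure; the integral that remains on the right does
  not involve \<open>c\<close>.\<close>

lemma nn_integral_power_law: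
  fixes h :: "real \<Rightarrow> ennreal" and c beta :: real
  assumes [measurable]: "h \<in> borel_measurable borel" and "0 < c" "0 < beta"
  defines "alpha \<equiv> real DIM('a) / beta"
  shows "(\<integral>\<^sup>+x. h (c * norm (x :: 'a::euclidean_space) powr (- beta)) \<partial>lborel)
    = ennreal (c powr alpha) * (ennreal (unit_sphere_area TYPE('a) / beta)
      * (\<integral>\<^sup>+s. h s * ennreal (s powr (- 1 - alpha)) * indicator {0<..} s \<partial>lborel))"
proof -
  define A where "A = unit_sphere_area TYPE('a) / beta"
  have "0 \<le> A"
    using \<open>0 < beta\<close> by (simp add: A_def unit_sphere_area_def)
  have radial: "(\<integral>\<^sup>+x. h (c * norm (x :: 'a) powr (- beta)) \<partial>lborel)
      = (\<integral>\<^sup>+s. h s \<partial>distr lborel borel (\<lambda>x::'a. c * norm x powr (- beta)))"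
    by (subst nn_integral_distr) simp_all
  from \<open>0 \<le> _\<close> have "(\<integral>\<^sup>+x. h (c * norm (x :: 'a) powr (- beta)) \<partial>lborel) =
     (\<integral>\<^sup>+s. ennreal (c powr alpha) * (ennreal A
      * (h s * ennreal (s powr (- 1 - alpha)) * indicator {0<..} s)) \<partial>lborel)"
    using assms(2,3)
    unfolding radial
    by (auto simp: distr_norm_powr_lborel A_def[symmetric] nn_integral_density ennreal_mult ac_simps alpha_def intro!: nn_integral_cong)
  then show ?thesis
    by (simp add: nn_integral_cmult A_def)
qed

text \<open>Near 0 the bound 1 - e^{-s} \<le> s leaves s^{-a}, integrable since a < 1; near infinity
  the bound by 1 leaves s^{-1-a}, integrable since a > 0.\<close>

lemma nn_integral_stable_kernel_finite:
  assumes "0 < a" "a < 1"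
  shows "(\<integral>\<^sup>+s. ennreal (1 - exp (- s)) * ennreal (s powr (- 1 - a)) * indicator {0<..} s \<partial>lborel) < \<top>"
proof -
  have le: "ennreal (1 - exp (- s)) * ennreal (s powr (- 1 - a)) * indicator {0<..} s
      \<le> ennreal (indicator {0..1} s * s powr (- a)) + ennreal (indicator {1..} s * s powr (- 1 - a))" for s :: real
  proof (cases "0 < s")
    case True
    define q where "q = (1 - exp (- s)) * s powr (- 1 - a)"
    have "q \<le> s * s powr (- 1 - a)"
      unfolding q_def using exp_ge_add_one_self[of "- s"] by (intro mult_right_mono) auto
    also have "\<dots> = s powr (- a)"
      using True by (simp add: powr_mult_base)
    finally have "q \<le> s powr (- a)" .
    moreover have "q \<le> 1 * s powr (- 1 - a)"
      unfolding q_def by (intro mult_right_mono) auto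
    ultimately have "q \<le> indicator {0..1} s * s powr (- a) + indicator {1..} s * s powr (- 1 - a)"
      using True by (auto simp: indicator_def)
    then show ?thesis
      using True by (simp add: q_def ennreal_leI flip: ennreal_mult ennreal_plus)
  qed simp
  have "(\<integral>\<^sup>+s. ennreal (indicator {0..1} s * s powr (- a)) \<partial>lborel) < \<top>"
    using nn_integral_has_integral_lebesgue[OF _ has_integral_powr_from_0[of "- a" 1]] assms by simp
  moreover have "(\<integral>\<^sup>+s. ennreal (indicator {1..} s * s powr (- 1 - a)) \<partial>lborel) < \<top>"
    using nn_integral_has_integral_lebesgue[OF _ has_integral_powr_to_inf[of "- 1 - a" 1]] assms by simp
  ultimately show ?thesis
    by (intro le_less_trans[OF nn_integral_mono[OF le]]) (simp add: nn_integral_add)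
qed

text \<open>In polar coordinates the integrand is r^{d-1-\<beta>}, whose exponent lies below
  -1.\<close>

lemma nn_integral_power_law_tail_finite:
  fixes delta beta :: real
  assumes "0 < delta" "real DIM('a) < beta"
  shows "(\<integral>\<^sup>+x. ennreal (norm (x :: 'a::euclidean_space) powr (- beta)) * indicator {delta..} (norm x) \<partial>lborel) < \<top>"
proof -
  define e where "e = real DIM('a) - 1 - beta"
  have "(\<integral>\<^sup>+r. ennreal (r ^ (DIM('a) - 1)) * (ennreal (r powr (- beta)) * indicator {delta..} r) * indicator {0<..} r \<partial>lborel)
     = (\<integral>\<^sup>+r. ennreal (indicator {delta..} r * r powr e) \<partial>lborel)"
    using \<open>0 < delta\<close>
    by (intro nn_integral_cong)
       (auto simp: indicator_def e_def of_nat_diff Suc_le_eq simp flip: ennreal_mult powr_realpow powr_add)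
  also have "\<dots> < \<top>"
    using nn_integral_has_integral_lebesgue[OF _ has_integral_powr_to_inf[of e delta]] assms by (simp add: e_def)
  finally show ?thesis
    by (subst nn_integral_radial[of "\<lambda>r. ennreal (r powr (- beta)) * indicator {delta..} r"])
       (simp_all add: ennreal_mult_less_top)
qed

section \<open>Asymptotics of the exponent\<close>

text \<open>Pointwise form of the upper bound, with \<open>d i\<close> the distance to the i-th
  centre: after splitting the sum, a near centre sees the exact power law and a far one is bounded
  linearly.\<close>

lemma one_minus_exp_neg_upper:
  assumes f: "\<And>r. 0 < r \<Longrightarrow> r < delta \<Longrightarrow> f r = ennreal (r powr (- beta))"
    and d: "\<And>i. i \<in> I \<Longrightarrow> 0 < d i"
  shows "ennreal (1 - exp_neg (\<Sum>i\<in>I. w i * f (d i)))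
    \<le> (\<Sum>i\<in>I. ennreal (1 - exp_neg (w i * ennreal (d i powr (- beta)))) + w i * (f (d i) * indicator {delta..} (d i)))"
proof (rule order_trans[OF one_minus_exp_neg_sum_le], rule sum_mono)
  fix i assume "i \<in> I"
  then show "ennreal (1 - exp_neg (w i * f (d i)))
    \<le> ennreal (1 - exp_neg (w i * ennreal (d i powr (- beta)))) + w i * (f (d i) * indicator {delta..} (d i))"
    using f[of "d i"] d[of i] one_minus_exp_neg_le[of "w i * f (d i)"]
    by (cases "d i < delta") (auto simp: not_less intro: add_increasing)
qed

text \<open>Hypothesis \<open>one\<close> allows at most one near index. Its term is bounded by the
  joint term through monotonicity, and every other index is far, so its term is absorbed by the
  linear error.\<close>

lemma one_minus_exp_neg_lower:
  assumes f: "\<And>r. 0 < r \<Longrightarrow> r < delta \<Longrightarrow> f r = ennreal (r powr (- beta))"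
    and d: "\<And>i. i \<in> I \<Longrightarrow> 0 < d i"
    and one: "\<And>i j. i \<in> I \<Longrightarrow> j \<in> I \<Longrightarrow> d i < delta \<Longrightarrow> d j < delta \<Longrightarrow> i = j"
    and "finite I"
  shows "(\<Sum>i\<in>I. ennreal (1 - exp_neg (w i * ennreal (d i powr (- beta)))))
    \<le> ennreal (1 - exp_neg (\<Sum>i\<in>I. w i * f (d i))) + (\<Sum>i\<in>I. w i * (ennreal (d i powr (- beta)) * indicator {delta..} (d i)))"
proof -
  let ?a = "\<lambda>i. w i * ennreal (d i powr (- beta))"
  let ?b = "\<lambda>i. w i * (ennreal (d i powr (- beta)) * indicator {delta..} (d i))"
  have far: "ennreal (1 - exp_neg (?a i)) \<le> ?b i" if "\<not> d i < delta" for i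
    using one_minus_exp_neg_le[of "?a i"] that by simp
  show ?thesis
  proof (cases "\<exists>i\<in>I. d i < delta")
    case False
    then have "(\<Sum>i\<in>I. ennreal (1 - exp_neg (?a i))) \<le> (\<Sum>i\<in>I. ?b i)"
      by (intro sum_mono far) auto
    then show ?thesis
      by (rule add_increasing[OF zero_le])
  next
    case True
    then obtain i where i: "i \<in> I" "d i < delta"
      by blast
    have "?a i = w i * f (d i)"
      using f[of "d i"] d[of i] i by simp
    also have "\<dots> \<le> (\<Sum>i\<in>I. w i * f (d i))"
      using i \<open>finite I\<close> by (intro member_le_sum) auto
    finally have near: "ennreal (1 - exp_neg (?a i)) \<le> ennreal (1 - exp_neg (\<Sum>i\<in>I. w i * f (d i)))"
      by (intro ennreal_leI diff_left_mono exp_neg_antimono)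
    have "(\<Sum>j\<in>I - {i}. ennreal (1 - exp_neg (?a j))) \<le> (\<Sum>j\<in>I - {i}. ?b j)"
      using one i by (intro sum_mono far) auto
    also have "\<dots> \<le> (\<Sum>j\<in>I. ?b j)"
      using \<open>finite I\<close> by (intro sum_mono2) auto
    finally show ?thesis
      using near unfolding sum.remove[OF \<open>finite I\<close> i(1), of "\<lambda>i. ennreal (1 - exp_neg (?a i))"]
      by (intro add_mono)
  qed
qed

text \<open>Integrates the two pointwise bounds over space for fixed weights. By translation
  invariance the centres matter only through their separation, and each contributes \<open>D\<close>
  times the power \<open>alpha\<close> of its weight.\<close>

lemma
  fixes z :: "'i \<Rightarrow> 'a::euclidean_space" and v :: "'i \<Rightarrow> real" and f :: "real \<Rightarrow> ennreal" and beta delta :: real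
  assumes [measurable]: "f \<in> borel_measurable borel"
    and f: "\<And>r. 0 < r \<Longrightarrow> r < delta \<Longrightarrow> f r = ennreal (r powr (- beta))"
    and "0 < beta" "finite I" and v: "\<And>i. i \<in> I \<Longrightarrow> 0 < v i"
    and sep: "\<And>i j x. i \<in> I \<Longrightarrow> j \<in> I \<Longrightarrow> dist x (z i) < delta \<Longrightarrow> dist x (z j) < delta \<Longrightarrow> i = j"
  defines "alpha \<equiv> real DIM('a) / beta"
  defines "K \<equiv> \<integral>\<^sup>+x. ennreal (1 - exp_neg (\<Sum>i\<in>I. ennreal (v i) * f (dist x (z i)))) \<partial>lborel"
  defines "D \<equiv> ennreal (unit_sphere_area TYPE('a) / beta)
      * (\<integral>\<^sup>+s. ennreal (1 - exp (- s)) * ennreal (s powr (- 1 - alpha)) * indicator {0<..} s \<partial>lborel)"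
  shows shot_noise_exponent_upper:
      "K \<le> (\<Sum>i\<in>I. ennreal (v i powr alpha)) * D
         + (\<Sum>i\<in>I. ennreal (v i)) * (\<integral>\<^sup>+x. f (norm (x::'a)) * indicator {delta..} (norm x) \<partial>lborel)" (is "_ \<le> _ + _ * ?e1")
    and shot_noise_exponent_lower:
      "(\<Sum>i\<in>I. ennreal (v i powr alpha)) * D
         \<le> K + (\<Sum>i\<in>I. ennreal (v i)) * (\<integral>\<^sup>+x. ennreal (norm (x::'a) powr (- beta)) * indicator {delta..} (norm x) \<partial>lborel)" (is "_ \<le> _ + _ * ?e2")
proof -
  let ?m = "\<lambda>i x. ennreal (1 - exp_neg (ennreal (v i) * ennreal (dist x (z i) powr (- beta))))"
  have main: "(\<integral>\<^sup>+x. ?m i x \<partial>lborel) = ennreal (v i powr alpha) * D" if "i \<in> I" for i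
  proof -
    have "(\<integral>\<^sup>+x. ?m i x \<partial>lborel)
        = (\<integral>\<^sup>+x. ennreal (1 - exp_neg (ennreal (v i) * ennreal (norm (x - z i) powr (- beta)))) \<partial>lborel)"
      by (simp add: dist_norm)
    also have "\<dots> = (\<integral>\<^sup>+x. ennreal (1 - exp_neg (ennreal (v i) * ennreal (norm (x::'a) powr (- beta)))) \<partial>lborel)"
      by (rule nn_integral_lborel_shift) measurable
    also have "\<dots> = (\<integral>\<^sup>+x. ennreal (1 - exp (- (v i * norm (x::'a) powr (- beta)))) \<partial>lborel)"
      using v[OF that] by (simp add: exp_neg_ennreal flip: ennreal_mult)
    also have "\<dots> = ennreal (v i powr alpha) * D"
      unfolding D_def alpha_def
      using nn_integral_power_law[of "\<lambda>s. ennreal (1 - exp (- s))" "v i" beta] v[OF that] \<open>0 < beta\<close> by simp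
    finally show ?thesis .
  qed
  have shift: "(\<integral>\<^sup>+x. h (dist x (z i)) * indicator {delta..} (dist x (z i)) \<partial>lborel)
      = (\<integral>\<^sup>+x. h (norm (x::'a)) * indicator {delta..} (norm x) \<partial>lborel)"
    if [measurable]: "h \<in> borel_measurable borel" for h :: "real \<Rightarrow> ennreal" and i
    unfolding dist_norm by (rule nn_integral_lborel_shift) measurable
  \<comment> \<open>The power law is assumed for positive radii only, so the finitely many centres
    are discarded as a null set.\<close>
  have pos: "AE x in lborel. \<forall>i\<in>I. 0 < dist x (z i)"
    using \<open>finite I\<close> by (auto simp: AE_finite_all intro: AE_lborel_singleton)
  have "K \<le> (\<integral>\<^sup>+x. (\<Sum>i\<in>I. ?m i x + ennreal (v i) * (f (dist x (z i)) * indicator {delta..} (dist x (z i)))) \<partial>lborel)"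
    unfolding K_def
    by (rule nn_integral_mono_AE, rule eventually_mono[OF pos], rule one_minus_exp_neg_upper[OF f]) auto
  also have "\<dots> = (\<Sum>i\<in>I. ennreal (v i powr alpha) * D + ennreal (v i) * ?e1)"
    by (subst nn_integral_sum) (auto simp: nn_integral_add nn_integral_cmult main shift)
  finally show "K \<le> (\<Sum>i\<in>I. ennreal (v i powr alpha)) * D + (\<Sum>i\<in>I. ennreal (v i)) * ?e1"
    by (simp only: sum.distrib sum_distrib_right)
  have "(\<Sum>i\<in>I. ennreal (v i powr alpha)) * D = (\<integral>\<^sup>+x. (\<Sum>i\<in>I. ?m i x) \<partial>lborel)"
    by (subst nn_integral_sum) (auto simp: main sum_distrib_right simp del: sum_ennreal)
  also have "\<dots> \<le> (\<integral>\<^sup>+x. ennreal (1 - exp_neg (\<Sum>i\<in>I. ennreal (v i) * f (dist x (z i))))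
      + (\<Sum>i\<in>I. ennreal (v i) * (ennreal (dist x (z i) powr (- beta)) * indicator {delta..} (dist x (z i)))) \<partial>lborel)"
    by (rule nn_integral_mono_AE, rule eventually_mono[OF pos], rule one_minus_exp_neg_lower[OF f])
       (use sep \<open>finite I\<close> in auto)
  also have "\<dots> = K + (\<Sum>i\<in>I. ennreal (v i) * ?e2)"
    unfolding K_def
    by (subst nn_integral_add, simp, simp, subst nn_integral_sum)
       (auto simp: nn_integral_cmult shift[of "\<lambda>r. ennreal (r powr (- beta))"])
  finally show "(\<Sum>i\<in>I. ennreal (v i powr alpha)) * D \<le> K + (\<Sum>i\<in>I. ennreal (v i)) * ?e2"
    by (simp only: sum_distrib_right)
qed

text \<open>Applies the fixed-weight bounds with weights \<open>p * t i * c\<close> and averages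
  over the mark \<open>p\<close>. The main term carries the moment of order \<open>alpha\<close>,
  the linear error the first moment.\<close>

lemma
  fixes z :: "nat \<Rightarrow> 'a::euclidean_space" and t :: "nat \<Rightarrow> real" and f :: "real \<Rightarrow> ennreal"
    and F :: "real measure" and beta delta lam :: real
  assumes F: "prob_space F" and F_sets [measurable_cong]: "sets F = sets borel" and F_pos: "AE p in F. 0 < p"
    and [measurable]: "f \<in> borel_measurable borel"
    and f: "\<And>r. 0 < r \<Longrightarrow> r < delta \<Longrightarrow> f r = ennreal (r powr (- beta))"
    and "0 < beta" "0 < lam" and t: "\<And>i. i < k \<Longrightarrow> 0 < t i"
    and sep: "\<And>i j x. i < k \<Longrightarrow> j < k \<Longrightarrow> dist x (z i) < delta \<Longrightarrow> dist x (z j) < delta \<Longrightarrow> i = j"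
  defines "alpha \<equiv> real DIM('a) / beta" and "kappa \<equiv> beta / real DIM('a)"
  defines "q \<equiv> ennreal lam * (\<integral>\<^sup>+x. \<integral>\<^sup>+p. ennreal (1 - exp_neg (ennreal p *
      (\<Sum>i<k. ennreal (t i) * (ennreal (lam powr (- kappa)) * f (dist x (z i)))))) \<partial>F \<partial>lborel)"
  defines "L \<equiv> ennreal (\<Sum>i<k. t i powr alpha) * (\<integral>\<^sup>+p. ennreal (p powr alpha) \<partial>F) *
      (ennreal (unit_sphere_area TYPE('a) / beta)
      * (\<integral>\<^sup>+s. ennreal (1 - exp (- s)) * ennreal (s powr (- 1 - alpha)) * indicator {0<..} s \<partial>lborel))"
  shows scaled_exponent_upper:
      "q \<le> L + ennreal (lam powr (1 - kappa)) * (ennreal (\<Sum>i<k. t i) * (\<integral>\<^sup>+p. ennreal p \<partial>F)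
        * (\<integral>\<^sup>+x. f (norm (x::'a)) * indicator {delta..} (norm x) \<partial>lborel))" (is "_ \<le> _ + _ * (_ * _ * ?e1)")
    and scaled_exponent_lower:
      "L \<le> q + ennreal (lam powr (1 - kappa)) * (ennreal (\<Sum>i<k. t i) * (\<integral>\<^sup>+p. ennreal p \<partial>F)
        * (\<integral>\<^sup>+x. ennreal (norm (x::'a) powr (- beta)) * indicator {delta..} (norm x) \<partial>lborel))" (is "_ \<le> _ + _ * (_ * _ * ?e2)")
proof -
  interpret F: prob_space F by fact
  interpret pair_sigma_finite F "lborel :: 'a measure" ..
  define c where "c = lam powr (- kappa)"
  define D where "D = ennreal (unit_sphere_area TYPE('a) / beta)
      * (\<integral>\<^sup>+s. ennreal (1 - exp (- s)) * ennreal (s powr (- 1 - alpha)) * indicator {0<..} s \<partial>lborel)"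
  define T1 Ta where "T1 = (\<Sum>i<k. t i)" and "Ta = (\<Sum>i<k. t i powr alpha)"
  define K where "K p = (\<integral>\<^sup>+x. ennreal (1 - exp_neg (\<Sum>i<k. ennreal (p * t i * c) * f (dist x (z i)))) \<partial>(lborel :: 'a measure))" for p
  have nonneg: "0 \<le> c" "0 \<le> T1" "0 \<le> Ta"
    using t by (auto simp: c_def T1_def Ta_def less_imp_le intro!: sum_nonneg)
  \<comment> \<open>Since \<open>alpha * kappa = 1\<close>, the main term scales as
    \<open>1 / lam\<close> and cancels the intensity, whereas the linear error scales as
    \<open>lam * c\<close>, a negative power of \<open>lam\<close> once
    \<open>kappa > 1\<close>.\<close>
  have "c powr alpha = lam powr (- 1)"
    using \<open>0 < beta\<close> by (simp add: c_def powr_powr alpha_def kappa_def)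
  then have ak: "c powr alpha = 1 / lam"
    using \<open>0 < lam\<close> by (simp add: powr_minus_divide)
  have lc: "lam * c = lam powr (1 - kappa)"
    using \<open>0 < lam\<close> by (simp add: c_def powr_mult_base)
  have [measurable]: "K \<in> borel_measurable F"
    unfolding K_def by measurable
  \<comment> \<open>Tonelli moves the mark outside, so that the spatial bounds apply for each fixed
    \<open>p\<close>. Positivity of \<open>p\<close> allows the factors to be merged inside one
    \<open>ennreal\<close>.\<close>
  have q: "q = ennreal lam * (\<integral>\<^sup>+p. K p \<partial>F)"
  proof -
    have "(\<integral>\<^sup>+x. \<integral>\<^sup>+p. ennreal (1 - exp_neg (ennreal p * (\<Sum>i<k. ennreal (t i) * (ennreal c * f (dist x (z i)))))) \<partial>F \<partial>lborel)
       = (\<integral>\<^sup>+p. \<integral>\<^sup>+x. ennreal (1 - exp_neg (ennreal p * (\<Sum>i<k. ennreal (t i) * (ennreal c * f (dist x (z i)))))) \<partial>lborel \<partial>F)"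
      by (rule Fubini') measurable
    also have "\<dots> = (\<integral>\<^sup>+p. K p \<partial>F)"
    proof (rule nn_integral_cong_AE, rule eventually_mono[OF F_pos])
      fix p :: real assume "0 < p"
      then have "ennreal p * (ennreal (t i) * (ennreal c * y)) = ennreal (p * t i * c) * y" if "i < k" for i y
        using t[OF that] nonneg by (simp add: ennreal_mult ac_simps)
      then show "(\<integral>\<^sup>+x. ennreal (1 - exp_neg (ennreal p * (\<Sum>i<k. ennreal (t i) * (ennreal c * f (dist x (z i)))))) \<partial>lborel) = K p"
        by (simp add: K_def sum_distrib_left)
    qed
    finally show ?thesis
      by (simp add: q_def c_def)
  qed
  have sums: "(\<Sum>i<k. ennreal ((p * t i * c) powr alpha)) = ennreal (Ta / lam) * ennreal (p powr alpha)"
      "(\<Sum>i<k. ennreal (p * t i * c)) = ennreal (T1 * c) * ennreal p" if "0 < p" for p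
  proof -
    have "(\<Sum>i<k. ennreal ((p * t i * c) powr alpha)) = ennreal (\<Sum>i<k. (p * t i * c) powr alpha)"
      by (rule sum_ennreal) simp
    also have "(\<Sum>i<k. (p * t i * c) powr alpha) = (\<Sum>i<k. t i powr alpha * (p powr alpha / lam))"
      using t that nonneg by (intro sum.cong) (auto simp: powr_mult ak)
    also have "\<dots> = Ta / lam * p powr alpha"
      by (simp add: Ta_def sum_distrib_right sum_divide_distrib)
    finally show "(\<Sum>i<k. ennreal ((p * t i * c) powr alpha)) = ennreal (Ta / lam) * ennreal (p powr alpha)"
      using nonneg \<open>0 < lam\<close> by (simp flip: ennreal_mult)
    have "(\<Sum>i<k. ennreal (p * t i * c)) = ennreal (\<Sum>i<k. p * t i * c)"
      using t that nonneg by (intro sum_ennreal) (simp add: less_imp_le)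
    then show "(\<Sum>i<k. ennreal (p * t i * c)) = ennreal (T1 * c) * ennreal p"
      using nonneg that by (simp add: T1_def ac_simps flip: ennreal_mult sum_distrib_left sum_distrib_right)
  qed
  have Ta: "ennreal lam * ennreal (Ta / lam) = ennreal Ta" and T1: "ennreal lam * ennreal (T1 * c) = ennreal (lam powr (1 - kappa)) * ennreal T1"
    using nonneg \<open>0 < lam\<close> by (simp_all add: lc[symmetric] ac_simps flip: ennreal_mult)
  have int: "ennreal lam * (\<integral>\<^sup>+p. (\<Sum>i<k. ennreal ((p * t i * c) powr alpha)) * D \<partial>F) = L"
  proof -
    have "(\<integral>\<^sup>+p. (\<Sum>i<k. ennreal ((p * t i * c) powr alpha)) * D \<partial>F) = (\<integral>\<^sup>+p. ennreal (Ta / lam) * (ennreal (p powr alpha) * D) \<partial>F)"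
      by (rule nn_integral_cong_AE, rule eventually_mono[OF F_pos], subst sums(1)) (simp_all add: mult.assoc)
    also have "\<dots> = ennreal (Ta / lam) * (\<integral>\<^sup>+p. ennreal (p powr alpha) \<partial>F) * D"
      by (simp add: nn_integral_cmult nn_integral_multc mult.assoc)
    finally show ?thesis
      unfolding L_def D_def[symmetric] Ta_def[symmetric] Ta[symmetric] by (simp only: mult.assoc)
  qed
  have int1: "ennreal lam * (\<integral>\<^sup>+p. (\<Sum>i<k. ennreal (p * t i * c)) * e \<partial>F)
      = ennreal (lam powr (1 - kappa)) * (ennreal T1 * (\<integral>\<^sup>+p. ennreal p \<partial>F) * e)" for e
  proof -
    have "(\<integral>\<^sup>+p. (\<Sum>i<k. ennreal (p * t i * c)) * e \<partial>F) = (\<integral>\<^sup>+p. ennreal (T1 * c) * (ennreal p * e) \<partial>F)"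
      by (rule nn_integral_cong_AE, rule eventually_mono[OF F_pos], subst sums(2)) (simp_all add: mult.assoc)
    also have "\<dots> = ennreal (T1 * c) * ((\<integral>\<^sup>+p. ennreal p \<partial>F) * e)"
      by (simp add: nn_integral_cmult nn_integral_multc)
    finally show ?thesis
      using T1 by (simp add: mult.assoc[symmetric])
  qed
  have cpos: "0 < c"
    using \<open>0 < lam\<close> by (simp add: c_def)
  have "(\<integral>\<^sup>+p. K p \<partial>F) \<le> (\<integral>\<^sup>+p. (\<Sum>i<k. ennreal ((p * t i * c) powr alpha)) * D + (\<Sum>i<k. ennreal (p * t i * c)) * ?e1 \<partial>F)"
    unfolding K_def D_def alpha_def
    by (rule nn_integral_mono_AE, rule eventually_mono[OF F_pos], rule shot_noise_exponent_upper)
       (use f \<open>0 < beta\<close> t cpos sep in auto)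
  then have "q \<le> ennreal lam * \<dots>"
    unfolding q by (rule mult_left_mono) simp
  then show "q \<le> L + ennreal (lam powr (1 - kappa)) * (ennreal (\<Sum>i<k. t i) * (\<integral>\<^sup>+p. ennreal p \<partial>F) * ?e1)"
    by (subst (asm) nn_integral_add) (simp_all add: distrib_left int int1 T1_def[symmetric] del: sum_ennreal)
  have "(\<integral>\<^sup>+p. (\<Sum>i<k. ennreal ((p * t i * c) powr alpha)) * D \<partial>F) \<le> (\<integral>\<^sup>+p. K p + (\<Sum>i<k. ennreal (p * t i * c)) * ?e2 \<partial>F)"
    unfolding K_def D_def alpha_def
    by (rule nn_integral_mono_AE, rule eventually_mono[OF F_pos], rule shot_noise_exponent_lower)
       (use f \<open>0 < beta\<close> t cpos sep in auto)
  then have "L \<le> ennreal lam * \<dots>"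
    unfolding int[symmetric] by (rule mult_left_mono) simp
  then show "L \<le> q + ennreal (lam powr (1 - kappa)) * (ennreal (\<Sum>i<k. t i) * (\<integral>\<^sup>+p. ennreal p \<partial>F) * ?e2)"
    by (subst (asm) nn_integral_add) (simp_all add: distrib_left q int1 T1_def[symmetric] del: sum_ennreal)
qed

section \<open>Passage to the limit of high intensity\<close>

theorem theorem1:
  fixes f :: "real \<Rightarrow> ennreal" and beta rho :: real and F :: "real measure"
    and M :: "real \<Rightarrow> 'w measure"
    and X :: "real \<Rightarrow> nat \<Rightarrow> 'w \<Rightarrow> 'a::euclidean_space"
    and P :: "real \<Rightarrow> nat \<Rightarrow> 'w \<Rightarrow> real"
    and k :: nat and xs :: "nat \<Rightarrow> 'a" and t :: "nat \<Rightarrow> real"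
  assumes beta: "beta > real DIM('a)"
    and f_meas: "f \<in> borel_measurable (restrict_space borel {0..})"
    and rho: "rho > 0"
    and f_zero: "f 0 = \<top>"
    and f_near: "\<And>r. 0 < r \<Longrightarrow> r \<le> rho \<Longrightarrow> f r = ennreal (r powr (- beta))"
    and f_sup: "(SUP r\<in>{rho..}. f r) < \<top>"
    and f_int: "(\<integral>\<^sup>+ r\<in>{rho..}. ennreal (r ^ (DIM('a) - 1)) * f r \<partial>lborel) < \<top>"
    and F: "prob_space F" "sets F = sets borel" "emeasure F {0<..} = 1"
    and F_mean: "(\<integral>\<^sup>+ p. ennreal p \<partial>F) < \<top>"
    and proc: "\<And>lam. lam > 0 \<Longrightarrow> indep_marked_ppp (M lam) lam F (X lam) (P lam)"
    and xs: "inj_on xs {..<k}"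
    and t: "\<And>i. i < k \<Longrightarrow> t i > 0"
  shows "((\<lambda>lam. laplace_I (M lam) lam (beta / real DIM('a)) f (X lam) (P lam) k xs t)
           \<longlongrightarrow> exp (- ((\<integral>p. p powr (real DIM('a) / beta) \<partial>F)
                      * (unit_sphere_area TYPE('a) / beta
                         * (LBINT s:{0<..}. (1 - exp (- s)) * s powr (- 1 - real DIM('a) / beta)))
                      * (\<Sum>i<k. t i powr (real DIM('a) / beta)))))
         at_top"
proof -
  define alpha kappa where "alpha = real DIM('a) / beta" and "kappa = beta / real DIM('a)"
  have "0 < beta"
    using beta by (rule le_less_trans[rotated]) simp
  then have alpha: "0 < alpha" "alpha < 1" and kappa: "1 < kappa"
    using beta by (simp_all add: alpha_def kappa_def)
  interpret F: prob_space F by fact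
  note [measurable_cong] = F(2)
  have F_pos: "AE p in F. 0 < p"
    using F.AE_prob_1[of "{0<..}"] F(3) by (simp add: measure_def)

  \<comment> \<open>Measurability of \<open>f\<close> is given on the nonnegative half-line only;
    the extension by 0 is Borel on the whole line and agrees with \<open>f\<close> at all
    distances.\<close>
  define f0 where "f0 r = f r * indicator {0..} r" for r
  have [measurable]: "f0 \<in> borel_measurable borel"
    using f_meas unfolding f0_def by (subst (asm) borel_measurable_restrict_space_iff_ennreal) auto
  have f_dist: "f (dist x y) = f0 (dist x y)" for x y :: 'a
    by (simp add: f0_def)

  \<comment> \<open>Half the pairwise distances: with \<open>delta\<close> at most their minimum,
    the open \<open>delta\<close>-balls around distinct centres are disjoint, and
    \<open>delta \<le> rho\<close> keeps them inside the range of the power law.\<close>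
  define S where "S = (\<lambda>(i, j). dist (xs i) (xs j) / 2) ` {(i, j) \<in> {..<k} \<times> {..<k}. i \<noteq> j}"
  define delta where "delta = Min (insert rho S)"
  have "finite S"
    unfolding S_def by (rule finite_imageI, rule finite_subset[of _ "{..<k} \<times> {..<k}"]) auto
  then have "delta \<in> insert rho S"
    unfolding delta_def by (intro Min_in) simp_all
  then have "0 < delta"
    using rho xs by (auto simp: S_def inj_on_def)
  have delta_le: "delta \<le> s" if "s \<in> insert rho S" for s
    unfolding delta_def using that \<open>finite S\<close> by (intro Min_le) simp_all
  then have "delta \<le> rho"
    by simp
  have sep: "i = j" if "i < k" "j < k" "dist x (xs i) < delta" "dist x (xs j) < delta" for i j x
  proof (rule ccontr)
    assume "i \<noteq> j"
    then have "dist (xs i) (xs j) / 2 \<in> S"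
      using that by (auto simp: S_def)
    then have "delta \<le> dist (xs i) (xs j) / 2"
      using delta_le by blast
    then show False
      using that dist_triangle2[of "xs i" "xs j" x] by (simp add: dist_commute)
  qed
  have near: "f0 r = ennreal (r powr (- beta))" if "0 < r" "r < delta" for r
    using f_near[of r] that \<open>delta \<le> rho\<close> by (simp add: f0_def)

  define C where "C = (\<integral>\<^sup>+s. ennreal (1 - exp (- s)) * ennreal (s powr (- 1 - alpha)) * indicator {0<..} s \<partial>lborel)"
  define m ma where "m = (\<integral>\<^sup>+p. ennreal p \<partial>F)" and "ma = (\<integral>\<^sup>+p. ennreal (p powr alpha) \<partial>F)"
  define T Ta where "T = (\<Sum>i<k. t i)" and "Ta = (\<Sum>i<k. t i powr alpha)"
  define e1 e2 where "e1 = (\<integral>\<^sup>+x. f0 (norm (x::'a)) * indicator {delta..} (norm x) \<partial>lborel)"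
    and "e2 = (\<integral>\<^sup>+x. ennreal (norm (x::'a) powr (- beta)) * indicator {delta..} (norm x) \<partial>lborel)"
  have "C < \<top>"
    unfolding C_def using alpha by (rule nn_integral_stable_kernel_finite)
  have "m < \<top>"
    using F_mean by (simp add: m_def)
  \<comment> \<open>The mean controls the moment of order \<open>alpha\<close> because p^\<alpha>
    \<le> 1 + p for \<alpha> < 1.\<close>
  have "ma \<le> (\<integral>\<^sup>+p. 1 + ennreal p \<partial>F)"
    unfolding ma_def
  proof (rule nn_integral_mono_AE, rule eventually_mono[OF F_pos])
    fix p :: real assume "0 < p"
    have "p powr alpha \<le> 1 + p"
    proof (cases "p \<le> 1")
      case True
      then show ?thesis
        using \<open>0 < p\<close> alpha powr_le1[of alpha p] by simp
    next
      case False
      then show ?thesis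
        using alpha powr_mono[of alpha 1 p] by simp
    qed
    then have "ennreal (p powr alpha) \<le> ennreal (1 + p)"
      by (rule ennreal_leI)
    then show "ennreal (p powr alpha) \<le> 1 + ennreal p"
      using \<open>0 < p\<close> by simp
  qed
  also have "\<dots> < \<top>"
    using F_mean by (subst nn_integral_add) (simp_all add: F.emeasure_space_1)
  finally have "ma < \<top>" .
  have "e2 < \<top>"
    unfolding e2_def using \<open>0 < delta\<close> beta by (rule nn_integral_power_law_tail_finite)
  \<comment> \<open>Between \<open>delta\<close> and \<open>rho\<close> the kernel is the power law,
    covered by \<open>e2\<close>; beyond \<open>rho\<close> the integrability hypothesis on
    \<open>f\<close> takes over.\<close>
  have "e1 \<le> (\<integral>\<^sup>+x. ennreal (norm (x::'a) powr (- beta)) * indicator {delta..} (norm x) + f0 (norm x) * indicator {rho..} (norm x) \<partial>lborel)"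
    unfolding e1_def
  proof (rule nn_integral_mono)
    fix x :: 'a
    show "f0 (norm x) * indicator {delta..} (norm x)
        \<le> ennreal (norm x powr (- beta)) * indicator {delta..} (norm x) + f0 (norm x) * indicator {rho..} (norm x)"
      using f_near[of "norm x"] \<open>0 < delta\<close>
      by (cases "x = 0"; cases "norm x < rho") (auto simp: f0_def indicator_def)
  qed
  also have "\<dots> = e2 + (\<integral>\<^sup>+x. f0 (norm (x::'a)) * indicator {rho..} (norm x) \<partial>lborel)"
    unfolding e2_def by (rule nn_integral_add) simp_all
  also have "(\<integral>\<^sup>+x. f0 (norm (x::'a)) * indicator {rho..} (norm x) \<partial>lborel)
      = ennreal (unit_sphere_area TYPE('a)) * (\<integral>\<^sup>+r. ennreal (r ^ (DIM('a) - 1)) * (f0 r * indicator {rho..} r) * indicator {0<..} r \<partial>lborel)"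
    by (rule nn_integral_radial[of "\<lambda>r. f0 r * indicator {rho..} r"]) simp
  also have "(\<integral>\<^sup>+r. ennreal (r ^ (DIM('a) - 1)) * (f0 r * indicator {rho..} r) * indicator {0<..} r \<partial>lborel)
      = (\<integral>\<^sup>+r\<in>{rho..}. ennreal (r ^ (DIM('a) - 1)) * f r \<partial>lborel)"
    using rho by (intro nn_integral_cong) (auto simp: f0_def indicator_def)
  finally have "e1 < \<top>"
    by (rule le_less_trans) (use f_int \<open>e2 < \<top>\<close> in \<open>simp add: ennreal_mult_less_top\<close>)

  define q where "q lam = ennreal lam * (\<integral>\<^sup>+x. \<integral>\<^sup>+p. ennreal (1 - exp_neg (ennreal p *
      (\<Sum>i<k. ennreal (t i) * (ennreal (lam powr (- kappa)) * f0 (dist x (xs i)))))) \<partial>F \<partial>lborel)" for lam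
  \<comment> \<open>The weighted combination of the interferences at the \<open>k\<close> points is
    a single shot noise with kernel \<open>?g\<close>, so one Laplace functional gives the joint
    transform.\<close>
  have laplace: "laplace_I (M lam) lam kappa f (X lam) (P lam) k xs t = exp_neg (q lam)" if "0 < lam" for lam
  proof -
    let ?g = "\<lambda>x. \<Sum>i<k. ennreal (t i) * (ennreal (lam powr (- kappa)) * f0 (dist x (xs i)))"
    have [measurable]: "\<And>n. X lam n \<in> borel_measurable (M lam)" "\<And>n. P lam n \<in> borel_measurable (M lam)"
      using proc[OF that] by (auto simp: indep_marked_ppp_def)
    have "(\<Sum>i<k. ennreal (t i) * (ennreal (lam powr (- kappa)) * interference f (X lam) (P lam) (xs i) \<omega>))
        = (\<Sum>n. ennreal (P lam n \<omega>) * ?g (X lam n \<omega>))" for \<omega>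
    proof -
      have "(\<Sum>n. ennreal (P lam n \<omega>) * ?g (X lam n \<omega>))
          = (\<Sum>n. \<Sum>i<k. ennreal (t i) * (ennreal (lam powr (- kappa)) * (ennreal (P lam n \<omega>) * f0 (dist (X lam n \<omega>) (xs i)))))"
        by (simp add: sum_distrib_left ac_simps)
      also have "\<dots> = (\<Sum>i<k. \<Sum>n. ennreal (t i) * (ennreal (lam powr (- kappa)) * (ennreal (P lam n \<omega>) * f0 (dist (X lam n \<omega>) (xs i)))))"
        by (rule suminf_sum) simp
      finally show ?thesis
        by (simp add: interference_def f_dist)
    qed
    then have "laplace_I (M lam) lam kappa f (X lam) (P lam) k xs t
        = (\<integral>\<omega>. exp_neg (\<Sum>n. ennreal (P lam n \<omega>) * ?g (X lam n \<omega>)) \<partial>M lam)"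
      by (simp add: laplace_I_def)
    also have "\<dots> = enn2real (\<integral>\<^sup>+\<omega>. ennreal (exp_neg (\<Sum>n. ennreal (P lam n \<omega>) * ?g (X lam n \<omega>))) \<partial>M lam)"
      by (rule integral_eq_nn_integral) auto
    also have "\<dots> = exp_neg (q lam)"
      using marked_poisson_laplace_functional[OF proc[OF that], of ?g] that by (simp add: q_def)
    finally show ?thesis .
  qed

  define L where "L = ennreal Ta * ma * (ennreal (unit_sphere_area TYPE('a) / beta) * C)"
  have upper: "q lam \<le> L + ennreal (lam powr (1 - kappa)) * (ennreal T * m * e1)" if "0 < lam" for lam
    unfolding q_def L_def T_def Ta_def m_def ma_def C_def e1_def alpha_def kappa_def
    using F(1,2) F_pos \<open>f0 \<in> _\<close> near \<open>0 < beta\<close> that t sep by (rule scaled_exponent_upper)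
  have lower: "L \<le> q lam + ennreal (lam powr (1 - kappa)) * (ennreal T * m * e2)" if "0 < lam" for lam
    unfolding q_def L_def T_def Ta_def m_def ma_def C_def e2_def alpha_def kappa_def
    using F(1,2) F_pos \<open>f0 \<in> _\<close> near \<open>0 < beta\<close> that t sep by (rule scaled_exponent_lower)
  have "L < \<top>" and E: "ennreal T * m * e1 < \<top>" "ennreal T * m * e2 < \<top>"
    using \<open>C < \<top>\<close> \<open>ma < \<top>\<close> \<open>m < \<top>\<close> \<open>e1 < \<top>\<close> \<open>e2 < \<top>\<close> by (simp_all add: L_def ennreal_mult_less_top)
  then obtain l E1 E2 where l: "L = ennreal l" "0 \<le> l" and E1: "ennreal T * m * e1 = ennreal E1" "0 \<le> E1"
    and E2: "ennreal T * m * e2 = ennreal E2" "0 \<le> E2"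
    by (meson less_top_ennreal)
  have decay: "((\<lambda>lam. lam powr (1 - kappa)) \<longlongrightarrow> 0) at_top"
    using kappa by (intro tendsto_neg_powr filterlim_ident) simp
  have "(q \<longlongrightarrow> ennreal l) at_top"
  proof (rule tendsto_sandwich)
    \<comment> \<open>The error is moved to the other side inside \<open>ennreal\<close>; when it
      exceeds \<open>l\<close> the difference truncates to 0 and the bound is trivial.\<close>
    show "\<forall>\<^sub>F lam in at_top. ennreal (l - lam powr (1 - kappa) * E2) \<le> q lam"
      using eventually_gt_at_top[of 0]
    proof eventually_elim
      case (elim lam)
      then have "ennreal l \<le> q lam + ennreal (lam powr (1 - kappa) * E2)"
        using lower[OF elim] l E2 by (simp add: ennreal_mult)
      then have "ennreal l - ennreal (lam powr (1 - kappa) * E2) \<le> q lam"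
        by (simp add: ennreal_minus_le_iff add.commute)
      then show ?case
        using E2 by (simp add: ennreal_minus)
    qed
    show "\<forall>\<^sub>F lam in at_top. q lam \<le> ennreal (l + lam powr (1 - kappa) * E1)"
      using eventually_gt_at_top[of 0]
      by eventually_elim (use upper l E1 in \<open>simp add: ennreal_mult\<close>)
    show "((\<lambda>lam. ennreal (l - lam powr (1 - kappa) * E2)) \<longlongrightarrow> ennreal l) at_top"
      using tendsto_diff[OF tendsto_const[of l] tendsto_mult_left_zero[OF decay, of E2]] by (intro tendsto_ennrealI) simp
    show "((\<lambda>lam. ennreal (l + lam powr (1 - kappa) * E1)) \<longlongrightarrow> ennreal l) at_top"
      using tendsto_add[OF tendsto_const[of l] tendsto_mult_left_zero[OF decay, of E1]] by (intro tendsto_ennrealI) simp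
  qed
  then have "((\<lambda>lam. exp_neg (q lam)) \<longlongrightarrow> exp (- l)) at_top"
    using tendsto_exp_neg[of q "ennreal l" at_top] l by (simp add: exp_neg_ennreal)
  then have lim: "((\<lambda>lam. laplace_I (M lam) lam kappa f (X lam) (P lam) k xs t) \<longlongrightarrow> exp (- l)) at_top"
    by (rule Lim_transform_eventually) (use eventually_gt_at_top[of 0] in \<open>eventually_elim, simp add: laplace\<close>)

  \<comment> \<open>The statement uses Bochner integrals. Their integrands are nonnegative, and
    \<open>ma\<close> and \<open>C\<close> are finite, so \<open>enn2real\<close> recovers the true
    values.\<close>
  have "(\<integral>p. p powr alpha \<partial>F) = enn2real ma"
    unfolding ma_def by (rule integral_eq_nn_integral) auto
  moreover have "(LBINT s:{0<..}. (1 - exp (- s)) * s powr (- 1 - alpha)) = enn2real C"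
  proof -
    have "(LBINT s:{0<..}. (1 - exp (- s)) * s powr (- 1 - alpha))
        = enn2real (\<integral>\<^sup>+s. ennreal (indicator {0<..} s *\<^sub>R ((1 - exp (- s)) * s powr (- 1 - alpha))) \<partial>lborel)"
      unfolding set_lebesgue_integral_def
      by (rule integral_eq_nn_integral) (auto simp: indicator_def)
    also have "(\<integral>\<^sup>+s. ennreal (indicator {0<..} s *\<^sub>R ((1 - exp (- s)) * s powr (- 1 - alpha))) \<partial>lborel) = C"
      unfolding C_def by (intro nn_integral_cong) (auto simp: indicator_def ennreal_mult)
    finally show ?thesis .
  qed
  moreover have "l = Ta * enn2real ma * (unit_sphere_area TYPE('a) / beta * enn2real C)"
  proof -
    have "0 \<le> Ta" "0 \<le> unit_sphere_area TYPE('a) / beta"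
      using \<open>0 < beta\<close> by (auto simp: Ta_def unit_sphere_area_def intro!: sum_nonneg)
    moreover have "l = enn2real L"
      using l by simp
    ultimately show ?thesis
      by (simp add: L_def enn2real_mult)
  qed
  ultimately show ?thesis
    using lim by (simp add: alpha_def[symmetric] kappa_def[symmetric] Ta_def[symmetric] ac_simps)
qed

end
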